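(* Let $K$ be a local field with finite residue field $k$ of characteristic $p$ and cardinality $q$, let $e>0$ be an integer with $e\not\equiv 0\pmod p$, and let $f>0$ be an integer such that $q^f\equiv 1\pmod e$. Let $K_f$ be the unramified extension of $K$ of degree $f$, $k_f$ its residue field, $G_f=\mathrm{Gal}(K_f|K)$, and let $\mathcal R_e(K_f)^{G_f}$ be the set of $G_f$-stable ramified lines in $K_f^\times/K_f^{\times e}$. Then for every $D\in\mathcal R_e(K_f)^{G_f}$, the canonical isomorphism $$H^2(G_f,k_f^\times/k_f^{\times e})_q\to H^2(G_f,{}_ek_f^\times)_q$$ induced by $\bar\xi\mapsto\xi^{(q^f-1)/e}$ sends the first cohomology class of $D$ to the second cohomology class of $D$ (both defined in the context).
   Context: A local field is a field complete for a discrete valuation with finite residue field. For an abelian group $A$ written multiplicatively, ${}_eA$ is the kernel of $x\mapsto x^e$. Elements of $k_f^\times$ are identified with their Teichmüller lifts in $K_f^\times$. Ramified lines: let $\bar w_f:K_f^\times/K_f^{\times e}\to\mathbf Z/e\mathbf Z$ be induced by the normalised valuation of $K_f$. A ramified line is a subgroup $D\subset K_f^\times/K_f^{\times e}$ on which $\bar w_f$ restricts to an isomorphism $D\to\mathbf Z/e\mathbf Z$. $G_f$ acts naturally on the set of ramified lines. Cohomology: $G_f$ is cyclic with canonical generator $\sigma$ inducing $x\mapsto x^q$ on $k_f$. For a $G_f$-module $C$ on which $\sigma$ acts by $x\mapsto x^q$ (such as $C=k_f^\times/k_f^{\times e}$ or $C={}_ek_f^\times$), $H^2(G_f,C)_q$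 is the kernel of $x\mapsto x^{q-1}$ on $C$ modulo the image of $x\mapsto x^{1+q+\cdots+q^{f-1}}$ on $C$. Classes of $D\in\mathcal R_e(K_f)^{G_f}$: choose a uniformiser $\pi$ of $K$ and $\xi\in k_f^\times$ such that $D$ is generated by the image of $\xi\pi$. The stability of $D$ gives $\bar\xi^{\,q-1}=1$ in $k_f^\times/k_f^{\times e}$. The first class of $D$ is the class of $\bar\xi$ in $H^2(G_f,k_f^\times/k_f^{\times e})_q$. For the second class, write $\xi^{q-1}=\alpha^e$ with $\alpha\in k_f^\times$ and put $\zeta=N_f(\alpha)$, where $N_f:k_f^\times\to k^\times$ is the norm; then $\zeta\in{}_ek_f^\times$ and $\zeta^{q-1}=1$, and the second class of $D$ is the class of $\zeta$ in $H^2(G_f,{}_ek_f^\times)_q$. Neither class depends on the choices made. *)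

theory Defs
  imports "HOL-Algebra.Algebra" "HOL-Number_Theory.Cong"
begin

section \<open>Local fields and unramified extensions\<close>

text \<open>A normalised discrete valuation is a map to the integers; it is only meaningful on nonzero
  elements, and all conditions below treat zero separately.\<close>

locale discretely_valued_field = field R for R (structure) +
  fixes v :: "'a \<Rightarrow> int"
  assumes val_mult: "\<lbrakk>x \<in> carrier R - {\<zero>}; y \<in> carrier R - {\<zero>}\<rbrakk> \<Longrightarrow> v (x \<otimes> y) = v x + v y"
    and val_add: "\<lbrakk>x \<in> carrier R - {\<zero>}; y \<in> carrier R - {\<zero>}; x \<oplus> y \<noteq> \<zero>\<rbrakk>
      \<Longrightarrow> min (v x) (v y) \<le> v (x \<oplus> y)"
    and val_surj: "v ` (carrier R - {\<zero>}) = UNIV"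

definition val_at_least :: "('a, 'm) ring_scheme \<Rightarrow> ('a \<Rightarrow> int) \<Rightarrow> int \<Rightarrow> 'a set" where
  "val_at_least R v n = {x \<in> carrier R. x = \<zero>\<^bsub>R\<^esub> \<or> n \<le> v x}"

definition val_Cauchy :: "('a, 'm) ring_scheme \<Rightarrow> ('a \<Rightarrow> int) \<Rightarrow> (nat \<Rightarrow> 'a) \<Rightarrow> bool" where
  "val_Cauchy R v s \<longleftrightarrow> (\<forall>N. \<exists>n0. \<forall>m\<ge>n0. \<forall>n\<ge>n0. s m \<ominus>\<^bsub>R\<^esub> s n \<in> val_at_least R v N)"

definition val_tendsto :: "('a, 'm) ring_scheme \<Rightarrow> ('a \<Rightarrow> int) \<Rightarrow> (nat \<Rightarrow> 'a) \<Rightarrow> 'a \<Rightarrow> bool" where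
  "val_tendsto R v s l \<longleftrightarrow> (\<forall>N. \<exists>n0. \<forall>n\<ge>n0. s n \<ominus>\<^bsub>R\<^esub> l \<in> val_at_least R v N)"

definition valuation_ring :: "('a, 'm) ring_scheme \<Rightarrow> ('a \<Rightarrow> int) \<Rightarrow> ('a, 'm) ring_scheme" where
  "valuation_ring R v = R\<lparr>carrier := val_at_least R v 0\<rparr>"

definition valuation_ideal :: "('a, 'm) ring_scheme \<Rightarrow> ('a \<Rightarrow> int) \<Rightarrow> 'a set" where
  "valuation_ideal R v = val_at_least R v 1"

definition residue_field :: "('a, 'm) ring_scheme \<Rightarrow> ('a \<Rightarrow> int) \<Rightarrow> 'a set ring" where
  "residue_field R v = valuation_ring R v Quot valuation_ideal R v"

locale local_field = discretely_valued_field R v for R (structure) and v +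
  assumes complete: "\<lbrakk>\<And>n. s n \<in> carrier R; val_Cauchy R v s\<rbrakk> \<Longrightarrow> \<exists>l\<in>carrier R. val_tendsto R v s l"
    and finite_residue_field: "finite (carrier (residue_field R v))"

definition has_characteristic :: "('a, 'm) ring_scheme \<Rightarrow> nat \<Rightarrow> bool" where
  "has_characteristic R p \<longleftrightarrow> (\<forall>n::nat. [n] \<cdot>\<^bsub>R\<^esub> \<one>\<^bsub>R\<^esub> = \<zero>\<^bsub>R\<^esub> \<longleftrightarrow> p dvd n)"

text \<open>The image in the residue field of \<open>L\<close> of the integers of the subfield \<open>K\<close>, that is, the
  residue field of \<open>K\<close> viewed inside the residue field of \<open>L\<close>.\<close>

definition residue_subfield :: "('a, 'm) ring_scheme \<Rightarrow> ('a \<Rightarrow> int) \<Rightarrow> 'a set \<Rightarrow> 'a set set" where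
  "residue_subfield L w K =
     (\<lambda>x. valuation_ideal L w +>\<^bsub>valuation_ring L w\<^esub> x) ` (K \<inter> val_at_least L w 0)"

text \<open>The normalised valuation \<open>w\<close> of \<open>L\<close> prolongs the normalised valuation \<open>v\<close> of \<open>K\<close>, up to
  the ramification index. A finite extension is unramified if its degree equals the residue
  degree and the residue extension is separable; the latter is automatic for finite fields.\<close>

locale unramified_extension = local_field L w for L (structure) and w +
  fixes K :: "'a set" and v :: "'a \<Rightarrow> int" and f :: nat
  assumes subfield: "subfield K L"
    and base_local_field: "local_field (L\<lparr>carrier := K\<rparr>) v"
    and prolongs: "\<exists>r::nat. 0 < r \<and> (\<forall>x \<in> K - {\<zero>}. w x = int r * v x)"
    and degree: "ring.dimension L f K (carrier L)"
    and residue_degree: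
      "ring.dimension (residue_field L w) f (residue_subfield L w K) (carrier (residue_field L w))"

definition uniformiser :: "('a, 'm) ring_scheme \<Rightarrow> ('a \<Rightarrow> int) \<Rightarrow> 'a \<Rightarrow> bool" where
  "uniformiser R v \<pi> \<longleftrightarrow> \<pi> \<in> carrier R - {\<zero>\<^bsub>R\<^esub>} \<and> v \<pi> = 1"

text \<open>Elements of the residue field are cosets, so \<open>x \<in> \<xi>\<close> says that \<open>x\<close> lifts \<open>\<xi>\<close>.\<close>

definition teichmueller :: "('a, 'm) ring_scheme \<Rightarrow> ('a \<Rightarrow> int) \<Rightarrow> 'a set \<Rightarrow> 'a" where
  "teichmueller R v \<xi> = (THE x. x \<in> \<xi> \<and> x [^]\<^bsub>R\<^esub> card (carrier (residue_field R v)) = x)"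

definition galois_group :: "('a, 'm) ring_scheme \<Rightarrow> 'a set \<Rightarrow> ('a \<Rightarrow> 'a) set" where
  "galois_group L K = {\<sigma> \<in> ring_iso L L \<inter> extensional (carrier L). \<forall>x\<in>K. \<sigma> x = x}"

text \<open>The norm of a finite Galois extension, as the product of the conjugates.\<close>

definition galois_norm :: "('a, 'm) ring_scheme \<Rightarrow> 'a set \<Rightarrow> 'a \<Rightarrow> 'a" where
  "galois_norm L K x = finprod L (\<lambda>\<sigma>. \<sigma> x) (galois_group L K)"


section \<open>Power quotients, torsion and cohomology\<close>

definition powers :: "('a, 'm) monoid_scheme \<Rightarrow> nat \<Rightarrow> 'a set" where
  "powers G n = (\<lambda>x. x [^]\<^bsub>G\<^esub> n) ` carrier G"

definition power_kernel :: "('a, 'm) monoid_scheme \<Rightarrow> nat \<Rightarrow> ('a, 'm) monoid_scheme" where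
  "power_kernel G n = G\<lparr>carrier := {x \<in> carrier G. x [^]\<^bsub>G\<^esub> n = \<one>\<^bsub>G\<^esub>}\<rparr>"

definition power_quotient :: "('a, 'm) monoid_scheme \<Rightarrow> nat \<Rightarrow> 'a set monoid" where
  "power_quotient G n = G Mod powers G n"

definition power_class :: "('a, 'm) monoid_scheme \<Rightarrow> nat \<Rightarrow> 'a \<Rightarrow> 'a set" where
  "power_class G n x = powers G n #>\<^bsub>G\<^esub> x"

text \<open>\<open>H2 C q f\<close> is the second cohomology of a cyclic group of order \<open>f\<close> with values in \<open>C\<close>, on
  which a fixed generator acts as \<open>x \<mapsto> x [^] q\<close>.\<close>

definition H2 :: "('a, 'm) monoid_scheme \<Rightarrow> nat \<Rightarrow> nat \<Rightarrow> 'a set monoid" where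
  "H2 C q f = power_kernel C (q - 1) Mod powers C (\<Sum>i<f. q ^ i)"

definition H2_class :: "('a, 'm) monoid_scheme \<Rightarrow> nat \<Rightarrow> nat \<Rightarrow> 'a \<Rightarrow> 'a set" where
  "H2_class C q f x = powers C (\<Sum>i<f. q ^ i) #>\<^bsub>C\<^esub> x"

text \<open>\<open>induced_map g A\<close> is the common value of \<open>g\<close> on the elements of the coset \<open>A\<close>.\<close>

definition induced_map :: "('a \<Rightarrow> 'b) \<Rightarrow> 'a set \<Rightarrow> 'b" where
  "induced_map g A = the_elem (g ` A)"

text \<open>For a finite field \<open>F\<close> of cardinality \<open>q ^ f\<close> and \<open>e\<close> dividing \<open>q ^ f - 1\<close>: the map from the
  multiplicative group modulo \<open>e\<close>-th powers to the \<open>e\<close>-torsion induced by raising to the power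
  \<open>(q ^ f - 1) / e\<close>, and the map it induces on \<open>H2\<close>.\<close>

definition canonical_H2_map ::
    "('a, 'm) ring_scheme \<Rightarrow> nat \<Rightarrow> nat \<Rightarrow> nat \<Rightarrow> 'a set set \<Rightarrow> 'a set" where
  "canonical_H2_map F e q f =
     induced_map (\<lambda>A. H2_class (power_kernel (units_of F) e) q f
       (induced_map (\<lambda>\<xi>. \<xi> [^]\<^bsub>F\<^esub> ((q ^ f - 1) div e)) A))"


section \<open>Ramified lines and their classes\<close>

definition ramified_line ::
    "('a, 'm) ring_scheme \<Rightarrow> ('a \<Rightarrow> int) \<Rightarrow> nat \<Rightarrow> 'a set set \<Rightarrow> bool" where
  "ramified_line L w e D \<longleftrightarrow>
     subgroup D (power_quotient (units_of L) e) \<and>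
     induced_map (\<lambda>x. w x mod int e)
       \<in> iso (power_quotient (units_of L) e\<lparr>carrier := D\<rparr>) (integer_mod_group e)"

definition stable_ramified_lines ::
    "('a, 'm) ring_scheme \<Rightarrow> ('a \<Rightarrow> int) \<Rightarrow> 'a set \<Rightarrow> nat \<Rightarrow> 'a set set set" where
  "stable_ramified_lines L w K e =
     {D. ramified_line L w e D \<and> (\<forall>\<sigma>\<in>galois_group L K. (\<lambda>A. \<sigma> ` A) ` D = D)}"

definition presents_line ::
    "('a, 'm) ring_scheme \<Rightarrow> ('a \<Rightarrow> int) \<Rightarrow> 'a set \<Rightarrow> ('a \<Rightarrow> int) \<Rightarrow> nat \<Rightarrow> 'a set set \<Rightarrow>
      'a \<Rightarrow> 'a set \<Rightarrow> bool" where
  "presents_line L w K v e D \<pi> \<xi> \<longleftrightarrow>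
     uniformiser (L\<lparr>carrier := K\<rparr>) v \<pi> \<and> \<xi> \<in> carrier (units_of (residue_field L w)) \<and>
     D = generate (power_quotient (units_of L) e)
           {power_class (units_of L) e (teichmueller L w \<xi> \<otimes>\<^bsub>L\<^esub> \<pi>)}"

text \<open>Definite descriptions are used for the two classes because they do not depend on the
  choices of \<open>\<pi>\<close>, \<open>\<xi>\<close> and \<open>\<alpha>\<close>.\<close>

definition first_class ::
    "('a, 'm) ring_scheme \<Rightarrow> ('a \<Rightarrow> int) \<Rightarrow> 'a set \<Rightarrow> ('a \<Rightarrow> int) \<Rightarrow> nat \<Rightarrow> nat \<Rightarrow> nat \<Rightarrow>
      'a set set \<Rightarrow> 'a set set set" where
  "first_class L w K v e q f D =
     (THE c. \<exists>\<pi> \<xi>. presents_line L w K v e D \<pi> \<xi> \<and>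
        c = H2_class (power_quotient (units_of (residue_field L w)) e) q f
              (power_class (units_of (residue_field L w)) e \<xi>))"

definition second_class ::
    "('a, 'm) ring_scheme \<Rightarrow> ('a \<Rightarrow> int) \<Rightarrow> 'a set \<Rightarrow> ('a \<Rightarrow> int) \<Rightarrow> nat \<Rightarrow> nat \<Rightarrow> nat \<Rightarrow>
      'a set set \<Rightarrow> 'a set set" where
  "second_class L w K v e q f D =
     (THE c. \<exists>\<pi> \<xi> \<alpha>. presents_line L w K v e D \<pi> \<xi> \<and>
        \<alpha> \<in> carrier (units_of (residue_field L w)) \<and>
        \<xi> [^]\<^bsub>residue_field L w\<^esub> (q - 1) = \<alpha> [^]\<^bsub>residue_field L w\<^esub> e \<and>
        c = H2_class (power_kernel (units_of (residue_field L w)) e) q f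
              (galois_norm (residue_field L w) (residue_subfield L w K) \<alpha>))"

end

theory Submission
  imports Defs
begin

text \<open>Put \<open>N = 1 + q + ... + q^(f-1)\<close> and \<open>e * m = q^f - 1\<close>. The residue field has a cyclic
  multiplicative group of order \<open>e * m = N * (q - 1)\<close>, and its norm is \<open>x \<mapsto> x^N\<close>. Comparing
  exponents of a generator, \<open>\<xi>^(q-1) = \<alpha>^e\<close> implies that \<open>\<xi>^m\<close> and \<open>\<alpha>^N\<close> differ by the \<open>N\<close>-th
  power of an \<open>e\<close>-torsion element, so the canonical map sends the first class to the second.

  That every stable line has such a presentation needs the Frobenius automorphism of the
  unramified extension. It is obtained as \<open>p(\<zeta>) \<mapsto> p(\<zeta>^q)\<close> for polynomials \<open>p\<close> over the base
  field, where \<open>\<zeta>\<close> is a Teichmueller lift of a generator of the residue field. Units are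
  Teichmueller lifts up to principal units, and the latter are \<open>e\<close>-th powers.\<close>

section \<open>Power quotients and cohomology of cyclic groups\<close>

text \<open>Both classes are definite descriptions, so each asks for a witness and for uniqueness.
  For the second class uniqueness falls out of the comparison itself: whatever \<pi>, \<xi> and
  \<alpha> are chosen, the class of the norm of \<alpha> is that of \<open>\<xi>^m\<close>, the
  image of the first class. For the first class, two presentations differ by an e-th power and by
  the residue of a unit of K, which is a norm. The witness \<alpha> is where stability enters.
  Stability speaks about members of \<open>galois_group L K\<close>, so it yields something only
  once an automorphism inducing x -> x^q on residues is at hand, while the locale provides two
  degrees and a valuation known up to a factor r. The equality of the degrees is exploited through a
  power basis of L that reduces to a basis of the residue field: it forces r = 1, controls
  integrality, and turns polynomial relations of \<zeta> into relations of its q-th power.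
  Polynomials occur as coefficient lists and mostly through their values.\<close>

lemma induced_map_eq:
  assumes "x \<in> A" "\<And>y. y \<in> A \<Longrightarrow> g y = g x"
  shows "induced_map g A = g x"
proof -
  have "g ` A = {g x}" using assms by blast
  then show ?thesis by (simp add: induced_map_def)
qed

context comm_group
begin

lemma powers_subgroup: "subgroup (powers G n) G"
proof
  show "powers G n \<subseteq> carrier G" by (auto simp: powers_def)
  show "x \<otimes> y \<in> powers G n" if xy: "x \<in> powers G n" "y \<in> powers G n" for x y
  proof -
    obtain a b where "a \<in> carrier G" "b \<in> carrier G" "x = a [^] n" "y = b [^] n"
      using xy by (auto simp: powers_def)
    then have "x \<otimes> y = (a \<otimes> b) [^] n" "a \<otimes> b \<in> carrier G"
      by (simp_all add: nat_pow_distrib)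
    then show ?thesis by (auto simp: powers_def)
  qed
  show "\<one> \<in> powers G n" unfolding powers_def by (rule image_eqI[of _ _ \<one>]) simp_all
  show "inv x \<in> powers G n" if x: "x \<in> powers G n" for x
  proof -
    obtain a where "a \<in> carrier G" "x = a [^] n" using x by (auto simp: powers_def)
    then have "inv x = (inv a) [^] n" "inv a \<in> carrier G" by (simp_all add: nat_pow_inv)
    then show ?thesis by (auto simp: powers_def)
  qed
qed

lemma powers_normal: "powers G n \<lhd> G"
  by (simp add: normal_iff_subgroup powers_subgroup)

lemma power_kernel_subgroup: "subgroup (carrier (power_kernel G n)) G"
  by unfold_locales (auto simp: power_kernel_def nat_pow_distrib nat_pow_inv)

lemma power_kernel_comm_group: "comm_group (power_kernel G n)"
proof -
  have eq: "G\<lparr>carrier := carrier (power_kernel G n)\<rparr> = power_kernel G n"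
    by (simp add: power_kernel_def)
  have "group (G\<lparr>carrier := carrier (power_kernel G n)\<rparr>)"
    by (rule subgroup_imp_group[OF power_kernel_subgroup])
  then interpret P: group "power_kernel G n" unfolding eq .
  show ?thesis by (rule P.group_comm_groupI) (auto simp: power_kernel_def m_comm)
qed

lemma power_quotient_comm_group: "comm_group (power_quotient G n)"
  unfolding power_quotient_def by (rule abelian_FactGroup[OF powers_subgroup])

lemma power_class_hom: "power_class G n \<in> hom G (power_quotient G n)"
  unfolding power_class_def power_quotient_def
  using normal.r_coset_hom_Mod[OF powers_normal] by (simp add: power_class_def)

lemma power_class_in_carrier: "x \<in> carrier G \<Longrightarrow> power_class G n x \<in> carrier (power_quotient G n)"
  using power_class_hom hom_in_carrier by fastforce

lemma power_quotient_carrier: "carrier (power_quotient G n) = power_class G n ` carrier G"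
  by (auto simp: power_quotient_def FactGroup_def RCOSETS_def power_class_def)

lemma power_class_mult:
  "x \<in> carrier G \<Longrightarrow> y \<in> carrier G \<Longrightarrow>
    power_class G n (x \<otimes> y) = power_class G n x \<otimes>\<^bsub>power_quotient G n\<^esub> power_class G n y"
  using power_class_hom by (simp add: hom_def)

lemma power_class_pow:
  assumes "x \<in> carrier G"
  shows "power_class G n (x [^] (k::nat)) = power_class G n x [^]\<^bsub>power_quotient G n\<^esub> k"
proof -
  interpret Q: comm_group "power_quotient G n" by (rule power_quotient_comm_group)
  interpret group_hom G "power_quotient G n" "power_class G n"
    by unfold_locales (rule power_class_hom)
  show ?thesis using assms by (simp add: hom_nat_pow)
qed

lemma power_class_self: "x \<in> carrier G \<Longrightarrow> x \<in> power_class G n x"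
  by (simp add: power_class_def powers_subgroup rcos_self)

lemma mem_power_class_iff:
  assumes "x \<in> carrier G"
  shows "y \<in> power_class G n x \<longleftrightarrow> (\<exists>z\<in>carrier G. y = x \<otimes> z [^] n)"
proof -
  have "y \<in> power_class G n x \<longleftrightarrow> (\<exists>z\<in>carrier G. y = z [^] n \<otimes> x)"
    by (simp add: power_class_def powers_def r_coset_def)
  also have "\<dots> \<longleftrightarrow> (\<exists>z\<in>carrier G. y = x \<otimes> z [^] n)"
    by (rule bex_cong[OF refl]) (simp add: m_comm assms)
  finally show ?thesis .
qed

lemma power_class_eq_iff:
  assumes "x \<in> carrier G" "y \<in> carrier G"
  shows "power_class G n x = power_class G n y \<longleftrightarrow> (\<exists>z\<in>carrier G. y = x \<otimes> z [^] n)"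
proof -
  have "power_class G n x = power_class G n y \<longleftrightarrow> y \<in> power_class G n x"
    unfolding power_class_def
    using repr_independence[OF _ assms(1) powers_subgroup, of y] rcos_self[OF assms(2) powers_subgroup] by metis
  then show ?thesis by (simp add: mem_power_class_iff[OF assms(1)])
qed

end

lemma power_kernel_simps [simp]:
  "x \<otimes>\<^bsub>power_kernel G n\<^esub> y = x \<otimes>\<^bsub>G\<^esub> y" "\<one>\<^bsub>power_kernel G n\<^esub> = \<one>\<^bsub>G\<^esub>"
  "x \<in> carrier (power_kernel G n) \<longleftrightarrow> x \<in> carrier G \<and> x [^]\<^bsub>G\<^esub> n = \<one>\<^bsub>G\<^esub>"
  by (auto simp: power_kernel_def)

lemma power_kernel_pow [simp]: "x [^]\<^bsub>power_kernel G n\<^esub> (k::nat) = x [^]\<^bsub>G\<^esub> k"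
  by (simp add: nat_pow_def)

section \<open>The second cohomology group as a kernel modulo norms\<close>

lemma H2_class_eq_power_class: "H2_class C q f x = power_class C (\<Sum>i<f. q ^ i) x"
  by (simp add: H2_class_def power_class_def)

lemma (in comm_group) powers_normal_power_kernel:
  assumes "\<And>x. x \<in> carrier G \<Longrightarrow> x [^] (m * n) = \<one>"
  shows "powers G m \<lhd> power_kernel G n"
proof -
  interpret P: comm_group "power_kernel G n" by (rule power_kernel_comm_group)
  have "powers G m \<subseteq> carrier (power_kernel G n)"
    using assms by (auto simp: powers_def nat_pow_pow)
  then have "subgroup (powers G m) (G\<lparr>carrier := carrier (power_kernel G n)\<rparr>)"
    by (rule subgroup_incl[OF powers_subgroup power_kernel_subgroup])
  moreover have "G\<lparr>carrier := carrier (power_kernel G n)\<rparr> = power_kernel G n"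
    by (simp add: power_kernel_def)
  ultimately show ?thesis by (simp add: P.normal_iff_subgroup)
qed

lemma iso_imp_group_hom: "group G \<Longrightarrow> group H \<Longrightarrow> \<phi> \<in> iso G H \<Longrightarrow> group_hom G H \<phi>"
  by (simp add: group_hom_def group_hom_axioms_def iso_def)

text \<open>The exponent is q^f - 1, so the condition says that the f-th iterate of x -> x^q is the
  identity on \<open>C\<close>. Then norms are fixed elements, and the factor group in
  \<open>H2\<close> is formed by a subgroup of the kernel.\<close>

locale H2_setting = comm_group C for C (structure) +
  fixes q f :: nat
  assumes annihilated: "x \<in> carrier C \<Longrightarrow> x [^] ((\<Sum>i<f. q ^ i) * (q - 1)) = \<one>"
begin

lemma powers_norm_normal: "powers C (\<Sum>i<f. q ^ i) \<lhd> power_kernel C (q - 1)"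
  by (rule powers_normal_power_kernel[OF annihilated])

lemma H2_group: "group (H2 C q f)"
  unfolding H2_def by (rule normal.factorgroup_is_group[OF powers_norm_normal])

text \<open>\<open>H2\<close> forms its cosets inside \<open>power_kernel C (q - 1)\<close>,
  \<open>H2_class\<close> forms them inside \<open>C\<close>. A coset depends on the multiplication
  alone, so both give the same set.\<close>

lemma r_coset_power_kernel: "H #>\<^bsub>power_kernel C n\<^esub> x = H #> x"
  by (simp add: r_coset_def)

lemma H2_class_hom: "H2_class C q f \<in> hom (power_kernel C (q - 1)) (H2 C q f)"
  using normal.r_coset_hom_Mod[OF powers_norm_normal]
  by (simp add: H2_def H2_class_def[abs_def] r_coset_power_kernel[abs_def])

lemma H2_carrier: "carrier (H2 C q f) = H2_class C q f ` carrier (power_kernel C (q - 1))"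
  by (auto simp: H2_def FactGroup_def RCOSETS_def H2_class_def r_coset_power_kernel)

lemma H2_class_eq_iff:
  "x \<in> carrier C \<Longrightarrow> y \<in> carrier C \<Longrightarrow>
    H2_class C q f x = H2_class C q f y \<longleftrightarrow> (\<exists>z\<in>carrier C. y = x \<otimes> z [^] (\<Sum>i<f. q ^ i))"
  unfolding H2_class_eq_power_class by (rule power_class_eq_iff)

lemma mem_H2_class_iff:
  "x \<in> carrier C \<Longrightarrow>
    y \<in> H2_class C q f x \<longleftrightarrow> (\<exists>z\<in>carrier C. y = x \<otimes> z [^] (\<Sum>i<f. q ^ i))"
  unfolding H2_class_eq_power_class by (rule mem_power_class_iff)

lemma one_H2: "\<one>\<^bsub>H2 C q f\<^esub> = H2_class C q f \<one>"
proof -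
  have "powers C (\<Sum>i<f. q ^ i) #> \<one> = powers C (\<Sum>i<f. q ^ i)"
    by (rule coset_mult_one) (simp add: powers_def image_subset_iff)
  then show ?thesis by (simp add: H2_def FactGroup_def H2_class_def)
qed

end

text \<open>The first isomorphism theorem, applied to \<phi> followed by the class map, on the
  kernel of x -> x^(q-1). As a bijective homomorphism, \<phi> respects this kernel and the N-th
  powers in both directions.\<close>

lemma H2_iso:
  assumes "comm_group C" "comm_group C'" and \<phi>: "\<phi> \<in> iso C C'"
    and ann: "\<And>x. x \<in> carrier C \<Longrightarrow> x [^]\<^bsub>C\<^esub> ((\<Sum>i<f. q ^ i) * (q - 1)) = \<one>\<^bsub>C\<^esub>"
  shows "induced_map (\<lambda>x. H2_class C' q f (\<phi> x)) \<in> iso (H2 C q f) (H2 C' q f)" (is "induced_map ?h \<in> _")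
    and "x \<in> carrier C \<Longrightarrow>
      induced_map (\<lambda>x. H2_class C' q f (\<phi> x)) (H2_class C q f x) = H2_class C' q f (\<phi> x)"
proof -
  interpret C: comm_group C by fact
  interpret C': comm_group C' by fact
  interpret \<phi>: group_hom C C' \<phi> by (rule iso_imp_group_hom) (use \<phi> in \<open>auto intro: C.is_group C'.is_group\<close>)
  have inj: "inj_on \<phi> (carrier C)" and surj: "\<phi> ` carrier C = carrier C'"
    using \<phi> by (auto simp: iso_def bij_betw_def)
  have "H2_setting C q f"
    by (rule H2_setting.intro, fact, rule H2_setting_axioms.intro, erule ann)
  then interpret S: H2_setting C q f .
  have ann': "y [^]\<^bsub>C'\<^esub> ((\<Sum>i<f. q ^ i) * (q - 1)) = \<one>\<^bsub>C'\<^esub>" if y: "y \<in> carrier C'" for y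
  proof -
    obtain x where x: "x \<in> carrier C" "y = \<phi> x" using y surj by auto
    then show ?thesis
      using \<phi>.hom_nat_pow[of x "(\<Sum>i<f. q ^ i) * (q - 1)", symmetric] by (simp only: ann \<phi>.hom_one)
  qed
  have "H2_setting C' q f"
    by (rule H2_setting.intro, fact, rule H2_setting_axioms.intro, erule ann')
  then interpret S': H2_setting C' q f .
  interpret P: comm_group "power_kernel C (q - 1)" by (rule C.power_kernel_comm_group)
  have \<phi>_kernel: "\<phi> x \<in> carrier (power_kernel C' (q - 1)) \<longleftrightarrow> x \<in> carrier (power_kernel C (q - 1))"
    if "x \<in> carrier C" for x
  proof -
    have "\<phi> x [^]\<^bsub>C'\<^esub> (q - 1) = \<one>\<^bsub>C'\<^esub> \<longleftrightarrow> x [^]\<^bsub>C\<^esub> (q - 1) = \<one>\<^bsub>C\<^esub>"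
      using inj_on_eq_iff[OF inj, of "x [^]\<^bsub>C\<^esub> (q - 1)" "\<one>\<^bsub>C\<^esub>"] that
      by (simp add: \<phi>.hom_nat_pow)
    then show ?thesis using that by simp
  qed
  have h_hom: "?h \<in> hom (power_kernel C (q - 1)) (H2 C' q f)"
  proof (rule homI)
    show "?h x \<in> carrier (H2 C' q f)" if "x \<in> carrier (power_kernel C (q - 1))" for x
      using that \<phi>_kernel[of x] by (auto simp: S'.H2_carrier)
    show "?h (x \<otimes>\<^bsub>power_kernel C (q - 1)\<^esub> y) = ?h x \<otimes>\<^bsub>H2 C' q f\<^esub> ?h y"
      if "x \<in> carrier (power_kernel C (q - 1))" "y \<in> carrier (power_kernel C (q - 1))" for x y
      using that \<phi>_kernel[of x] \<phi>_kernel[of y] hom_mult[OF S'.H2_class_hom, of "\<phi> x" "\<phi> y"] by simp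
  qed
  interpret h: group_hom "power_kernel C (q - 1)" "H2 C' q f" ?h
    by (intro group_hom.intro group_hom_axioms.intro h_hom S'.H2_group P.is_group)
  have "?h x = \<one>\<^bsub>H2 C' q f\<^esub> \<longleftrightarrow> x \<in> powers C (\<Sum>i<f. q ^ i)" if "x \<in> carrier C" for x
  proof -
    have "?h x = \<one>\<^bsub>H2 C' q f\<^esub> \<longleftrightarrow> (\<exists>z\<in>carrier C'. \<phi> x = z [^]\<^bsub>C'\<^esub> (\<Sum>i<f. q ^ i))"
      using that S'.H2_class_eq_iff[of "\<one>\<^bsub>C'\<^esub>" "\<phi> x"] by (auto simp: S'.one_H2)
    also have "\<dots> \<longleftrightarrow> (\<exists>z\<in>carrier C. \<phi> x = \<phi> (z [^]\<^bsub>C\<^esub> (\<Sum>i<f. q ^ i)))"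
      by (simp add: surj[symmetric] \<phi>.hom_nat_pow)
    also have "\<dots> \<longleftrightarrow> (\<exists>z\<in>carrier C. x = z [^]\<^bsub>C\<^esub> (\<Sum>i<f. q ^ i))"
      using inj_on_eq_iff[OF inj that] by (intro bex_cong) auto
    finally show ?thesis by (auto simp: powers_def)
  qed
  \<comment> \<open>The preceding equivalence was shown on all of \<open>C\<close>; restricting it
    to the kernel of x -> x^(q-1) loses nothing, because the N-th powers already lie there.\<close>
  then have "kernel (power_kernel C (q - 1)) (H2 C' q f) ?h = powers C (\<Sum>i<f. q ^ i)"
    using subgroup.subset[OF normal_imp_subgroup[OF S.powers_norm_normal]]
    unfolding kernel_def by (intro equalityI subsetI) (force, simp add: subset_iff)
  moreover have "?h ` carrier (power_kernel C (q - 1)) = carrier (H2 C' q f)"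
  proof -
    have "carrier (power_kernel C' (q - 1)) = \<phi> ` carrier (power_kernel C (q - 1))"
    proof (intro equalityI subsetI)
      fix y assume y: "y \<in> carrier (power_kernel C' (q - 1))"
      then obtain x where "x \<in> carrier C" "y = \<phi> x" using surj by auto
      then show "y \<in> \<phi> ` carrier (power_kernel C (q - 1))" using y \<phi>_kernel[of x] by blast
    qed (use \<phi>_kernel in auto)
    then show ?thesis by (simp add: S'.H2_carrier image_image)
  qed
  ultimately show "induced_map ?h \<in> iso (H2 C q f) (H2 C' q f)"
    using h.FactGroup_iso_set unfolding H2_def induced_map_def[abs_def] by simp
  show "induced_map ?h (H2_class C q f x) = ?h x" if x: "x \<in> carrier C" for x
  proof (rule induced_map_eq)
    show "x \<in> H2_class C q f x" unfolding H2_class_eq_power_class by (rule C.power_class_self[OF x])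
    fix y assume "y \<in> H2_class C q f x"
    then obtain z where z: "z \<in> carrier C" "y = x \<otimes>\<^bsub>C\<^esub> z [^]\<^bsub>C\<^esub> (\<Sum>i<f. q ^ i)"
      using S.mem_H2_class_iff[OF x] by blast
    then have "\<phi> y = \<phi> x \<otimes>\<^bsub>C'\<^esub> \<phi> z [^]\<^bsub>C'\<^esub> (\<Sum>i<f. q ^ i)"
      using x by (simp add: \<phi>.hom_nat_pow)
    then show "?h y = ?h x"
      using S'.H2_class_eq_iff[of "\<phi> x" "\<phi> y"] x z by auto
  qed
qed

section \<open>Roots and exponents in finite cyclic groups\<close>

locale finite_cyclic_group = comm_group G for G (structure) +
  fixes g
  assumes finite: "finite (carrier G)" and gen: "g \<in> carrier G"
    and generates: "x \<in> carrier G \<Longrightarrow> \<exists>i::nat. x = g [^] i"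
begin

lemma ord_gen: "ord g = order G"
proof -
  have "carrier G = {g [^] i |i. i \<in> (UNIV::nat set)}"
    using generates gen by (auto intro: nat_pow_closed)
  then show ?thesis
    unfolding order_def generate_pow_card[OF gen] generate_pow_on_finite_carrier[OF finite gen]
    by (rule arg_cong[OF sym])
qed

text \<open>If x = g^i, the order \<open>d * m\<close> of the generator divides
  \<open>i * m\<close>, and cancelling \<open>m\<close> leaves d dividing i. Besides the kernel and
  image of powering, this later gives the surjectivity of the norm onto the units of the base
  field.\<close>

lemma exists_root:
  assumes "order G = d * m" "x \<in> carrier G" "x [^] m = \<one>"
  shows "\<exists>y\<in>carrier G. x = y [^] d"
proof -
  have "order G > 0" using finite by (simp add: order_gt_0_iff_finite)
  obtain i :: nat where i: "x = g [^] i" using generates assms(2) by blast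
  have "g [^] (i * m) = \<one>" using gen assms(3) by (simp add: i nat_pow_pow)
  then have "d * m dvd i * m" using pow_eq_id[OF gen, of "i * m"] ord_gen assms(1) by simp
  then obtain j where "i = d * j" using \<open>order G > 0\<close> assms(1) by (auto simp: dvd_def)
  then have "x = (g [^] j) [^] d" using gen by (simp add: i nat_pow_pow mult.commute)
  then show ?thesis using gen by blast
qed

text \<open>\<open>exists_root\<close> is used twice with the factors exchanged: with d = e it
  computes the kernel of x -> x^m, with d = m its image.\<close>

lemma power_iso:
  assumes "order G = e * m"
  shows "induced_map (\<lambda>x. x [^] m) \<in> iso (power_quotient G e) (power_kernel G e)"
    and "x \<in> carrier G \<Longrightarrow> induced_map (\<lambda>x. x [^] m) (power_class G e x) = x [^] m"
proof -
  have one: "(x [^] e) [^] m = \<one>" "(x [^] m) [^] e = \<one>" if "x \<in> carrier G" for x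
    using that pow_order_eq_1[OF that] by (simp_all add: assms nat_pow_pow mult.commute)
  interpret K: comm_group "power_kernel G e" by (rule power_kernel_comm_group)
  have "(\<lambda>x. x [^] m) \<in> hom G (power_kernel G e)"
    by (rule homI) (simp_all add: one nat_pow_distrib)
  then interpret h: group_hom G "power_kernel G e" "\<lambda>x. x [^] m"
    by (intro group_hom.intro group_hom_axioms.intro is_group K.is_group)
  have "kernel G (power_kernel G e) (\<lambda>x. x [^] m) = powers G e"
    using exists_root[OF assms] one(1) by (auto simp: kernel_def powers_def)
  moreover have "(\<lambda>x. x [^] m) ` carrier G = carrier (power_kernel G e)"
  proof (intro equalityI subsetI)
    fix x assume "x \<in> carrier (power_kernel G e)"
    then show "x \<in> (\<lambda>x. x [^] m) ` carrier G"
      using exists_root[of m e x] assms by (auto simp: mult.commute)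
  qed (use one(2) in auto)
  ultimately show "induced_map (\<lambda>x. x [^] m) \<in> iso (power_quotient G e) (power_kernel G e)"
    using h.FactGroup_iso_set unfolding power_quotient_def induced_map_def[abs_def] by simp
  show "induced_map (\<lambda>x. x [^] m) (power_class G e x) = x [^] m" if x: "x \<in> carrier G" for x
  proof (rule induced_map_eq[OF power_class_self[OF x]])
    fix y assume "y \<in> power_class G e x"
    then obtain z where "z \<in> carrier G" "y = x \<otimes> z [^] e" using mem_power_class_iff[OF x] by auto
    then show "y [^] m = x [^] m" using x by (simp add: nat_pow_distrib one)
  qed
qed

text \<open>With x = g^a and y = g^b the hypothesis reads a d = b e + e m c for an integer c,
  possibly negative. Multiplying by m, replacing e m by n d and cancelling d gives a m = b n + c m
  n. So z = g^(c m) works, and z^e = 1 because e m is the group order. The application has d = q - 1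
  and n = N.\<close>

lemma power_kernel_class_eq:
  assumes ord: "order G = e * m" "order G = n * d" and "0 < d"
    and x: "x \<in> carrier G" "y \<in> carrier G" "x [^] d = y [^] e"
  shows "\<exists>z\<in>carrier (power_kernel G e). x [^] m = y [^] n \<otimes> z [^] n"
proof -
  obtain a b :: nat where ab: "x = g [^] a" "y = g [^] b" using generates x by metis
  let ?N = "int (order G)"
  have "g [^] (int a * int d - int b * int e) = \<one>"
  proof -
    have "g [^] (int a * int d) = g [^] (int b * int e)"
      using x(3) gen by (simp add: ab nat_pow_pow int_pow_int flip: of_nat_mult)
    then show ?thesis using gen by (simp add: int_pow_diff)
  qed
  then have "int (ord g) dvd int a * int d - int b * int e"
    using int_pow_eq_id[OF gen] by blast
  then obtain c where c: "int a * int d - int b * int e = ?N * c"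
    using ord_gen by auto
  have "int a * int m = int b * int n + c * int m * int n"
  proof -
    have "int a * int d = int b * int e + ?N * c" using c by simp
    then have "(int a * int m) * int d = (int b * int e + ?N * c) * int m"
      by (metis mult.assoc mult.commute)
    also have "\<dots> = int b * ?N + ?N * c * int m" by (simp add: ord(1) algebra_simps)
    also have "\<dots> = (int b * int n + c * int m * int n) * int d" by (simp add: ord(2) algebra_simps)
    finally show ?thesis using \<open>0 < d\<close> by simp
  qed
  then have "g [^] (int a * int m) = g [^] (int b * int n) \<otimes> g [^] (c * int m * int n)"
    using gen by (simp add: int_pow_mult)
  moreover have "x [^] m = g [^] (int a * int m)" "y [^] n = g [^] (int b * int n)"
    using gen by (simp_all add: ab nat_pow_pow int_pow_int flip: of_nat_mult)
  moreover have "g [^] (c * int m * int n) = (g [^] (c * int m)) [^] n"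
    using gen by (simp add: int_pow_pow flip: int_pow_int)
  moreover have "(g [^] (c * int m)) [^] e = \<one>"
  proof -
    have "(g [^] (c * int m)) [^] e = (g [^] order G) [^] c"
      using gen by (simp add: int_pow_pow ord(1) mult.commute mult.left_commute flip: int_pow_int)
    then show ?thesis using pow_order_eq_1[OF gen] by simp
  qed
  ultimately show ?thesis using gen by (intro bexI[of _ "g [^] (c * int m)"]) simp_all
qed

end

section \<open>Finite field extensions\<close>

declare (in ring) poly_add.simps [simp del]

lemma (in ring) eval_scale:
  assumes "a \<in> carrier R" "set p \<subseteq> carrier R" "x \<in> carrier R"
  shows "eval (map ((\<otimes>) a) p) x = a \<otimes> eval p x"
  using assms(2)
  by (induction p) (use assms(1,3) in \<open>simp_all add: eval_in_carrier r_distr m_assoc\<close>)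

lemma (in ring) eval_zero_coeffs:
  assumes "set p \<subseteq> {\<zero>}" "x \<in> carrier R"
  shows "eval p x = \<zero>"
  using assms by (induction p) auto

text \<open>Independent vectors as many as the dimension form a spanning family; the independence of
  1, g, ..., g^(n-1) is expressed by values of coefficient lists. This serves for a generator of the
  residue field and again for its Teichmueller lift.\<close>

lemma (in ring) exists_eval_if_independent_powers:
  assumes K: "subfield K R" and g: "g \<in> carrier R" and dim: "dimension n K (carrier R)"
    and zero: "\<And>p. set p \<subseteq> K \<Longrightarrow> length p \<le> n \<Longrightarrow> eval p g = \<zero> \<Longrightarrow> set p \<subseteq> {\<zero>}"
    and x: "x \<in> carrier R"
  shows "\<exists>p. set p \<subseteq> K \<and> length p = n \<and> x = eval p g"
proof -
  let ?B = "exp_base g n"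
  have len: "length ?B = n" by (simp add: exp_base_def)
  have K_sub: "K \<subseteq> carrier R" "\<zero> \<in> K"
    using subfieldE(3)[OF K] subringE(2)[OF subfieldE(1)[OF K]] by auto
  have "independent K ?B"
  proof (rule trivial_combine_imp_independent[OF K exp_base_closed[OF g]])
    fix Ks assume Ks: "set Ks \<subseteq> K" "combine Ks ?B = \<zero>"
    show "set (take (length ?B) Ks) \<subseteq> {\<zero>}"
    proof (rule ccontr)
      assume nz: "\<not> set (take (length ?B) Ks) \<subseteq> {\<zero>}"
      have "set Ks \<subseteq> carrier R" using Ks(1) K_sub by auto
      \<comment> \<open>\<open>combine\<close> stops at the shorter of its two lists, while
        \<open>eval\<close> reads the degree off the length. So \<open>Ks\<close> is first cut or
        padded to the length of the base.\<close>
      from combine_normalize[OF this exp_base_closed[OF g] refl] obtain Ks' where Ks':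
        "set (take (length ?B) Ks) \<subseteq> set Ks'" "set Ks' \<subseteq> set (take (length ?B) Ks) \<union> {\<zero>}"
        "length Ks' = length ?B" "combine Ks' ?B = combine Ks ?B"
        by metis
      have "set Ks' \<subseteq> K" using Ks'(2) Ks(1) set_take_subset[of _ Ks] K_sub by blast
      then have "set Ks' \<subseteq> {\<zero>}"
        using zero[of Ks'] combine_eq_eval[of Ks' g] Ks'(3,4) Ks(2) len by simp
      then show False using Ks'(1) nz by blast
    qed
  qed
  from independent_length_eq_dimension[OF K dim this exp_base_closed[OF g]] len
  have span: "Span K ?B = carrier R" by simp
  from x span obtain p where p: "set p \<subseteq> K" "length p = length ?B" "x = combine p ?B"
    using Span_mem_iff_length_version[OF K exp_base_closed[OF g], of x n] by metis
  then show ?thesis using combine_eq_eval[of p g] len by auto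
qed

text \<open>Division by a monic polynomial works over any subring, and it is needed over the
  integers of K as well as over K. The induction follows Horner's scheme: appending a coefficient to
  \<open>h\<close> multiplies by x and adds a constant, and a remainder that has become too long is
  shortened by a multiple of the divisor.\<close>

lemma (in cring) eval_monic_division:
  assumes A: "subring A R" and c: "set c \<subseteq> A" and h: "set h \<subseteq> A"
  shows "\<exists>r s. set r \<subseteq> A \<and> set s \<subseteq> A \<and> length s \<le> length c \<and>
    (\<forall>x\<in>carrier R. eval h x = eval (\<one> # c) x \<otimes> eval r x \<oplus> eval s x)"
  using h
proof (induction h rule: rev_induct)
  case Nil
  have "eval (\<one> # c) x \<in> carrier R" if "x \<in> carrier R" for x
    using subringE(1)[OF A] c that by (intro eval_in_carrier) auto
  then show ?case by (intro exI[of _ "[]"]) auto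
next
  case (snoc b h)
  note A_simps = subringE[OF A]
  obtain r s where rs: "set r \<subseteq> A" "set s \<subseteq> A" "length s \<le> length c"
    and eq: "\<And>x. x \<in> carrier R \<Longrightarrow> eval h x = eval (\<one> # c) x \<otimes> eval r x \<oplus> eval s x"
    using snoc by auto
  have b: "b \<in> A" and hA: "set h \<subseteq> A" using snoc.prems by auto
  have carr: "set h \<subseteq> carrier R" "set r \<subseteq> carrier R" "set s \<subseteq> carrier R" "set c \<subseteq> carrier R" "b \<in> carrier R"
    using hA rs c b A_simps(1) by auto
  have ev: "eval (\<one> # c) x \<in> carrier R" "eval r x \<in> carrier R" "eval s x \<in> carrier R" "eval c x \<in> carrier R"
    if "x \<in> carrier R" for x
    using carr that by (auto intro!: eval_in_carrier)
  have eq': "eval (h @ [b]) x = eval (\<one> # c) x \<otimes> (eval r x \<otimes> x) \<oplus> eval (s @ [b]) x"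
    if x: "x \<in> carrier R" for x
    unfolding eval_append_aux[OF carr(1,5) x] eval_append_aux[OF carr(3,5) x] eq[OF x]
    using ev[OF x] carr(5) x by algebra
  show ?case
  proof (cases "length (s @ [b]) \<le> length c")
    case True
    have "eval (r @ [\<zero>]) x = eval r x \<otimes> x" if x: "x \<in> carrier R" for x
      using eval_append_aux[OF carr(2) zero_closed x] ev[OF x] x by simp
    then show ?thesis
      using True eq' rs b A_simps(2) by (intro exI[of _ "r @ [\<zero>]"] exI[of _ "s @ [b]"]) simp
  next
    case False
    then have len: "length (s @ [b]) = Suc (length c)" using rs(3) by simp
    obtain a s' where s_eq: "s @ [b] = a # s'" by (cases "s @ [b]") auto
    then have s': "s @ [b] = a # s'" "length s' = length c" using len by (simp_all only: list.size)
    have "set (s @ [b]) \<subseteq> A" using rs(2) b by simp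
    then have as: "a \<in> A" "set s' \<subseteq> A" unfolding s_eq by simp_all
    then have carr': "a \<in> carrier R" "set s' \<subseteq> carrier R" "\<ominus> a \<in> carrier R" using A_simps(1) by auto
    \<comment> \<open>The top power x^(length c) equals the value of the divisor minus
      \<open>eval c x\<close>. Hence \<open>a\<close> moves into the quotient as its new last
      coefficient, and \<open>- a * c\<close> is added to the remainder.\<close>
    let ?c = "map ((\<otimes>) (\<ominus> a)) c"
    have c': "set ?c \<subseteq> A" using c as(1) A_simps(5,6) by auto
    then have c'_carr: "set ?c \<subseteq> carrier R" using A_simps(1) by auto
    have "eval (h @ [b]) x = eval (\<one> # c) x \<otimes> eval (r @ [a]) x \<oplus> eval (poly_add s' ?c) x"
      if x: "x \<in> carrier R" for x
    proof -
      have "eval s' x \<in> carrier R" by (rule eval_in_carrier[OF carr'(2) x])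
      moreover have "eval (s @ [b]) x = a \<otimes> x [^] length c \<oplus> eval s' x" by (simp add: s')
      moreover have "eval (\<one> # c) x = x [^] length c \<oplus> eval c x" using x by simp
      ultimately show ?thesis
        unfolding eq'[OF x] eval_append_aux[OF carr(2) carr'(1) x] eval_poly_add[OF carr'(2) c'_carr x]
          eval_scale[OF carr'(3) carr(4) x]
        using ev[OF x] carr' x nat_pow_closed[OF x, of "length c"] by algebra
    qed
    moreover have "set (poly_add s' ?c) \<subseteq> A"
      by (rule polynomial_incl[OF poly_add_is_polynomial[OF A as(2) c']])
    moreover have "length (poly_add s' ?c) \<le> length c"
      using poly_add_length_le[of s' ?c] s'(2) by simp
    ultimately show ?thesis
      using rs(1) as(1) by (intro exI[of _ "r @ [a]"] exI[of _ "poly_add s' ?c"]) simp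
  qed
qed

lemma (in domain) pow_eq_zeroD:
  assumes "x [^] (n::nat) = \<zero>" "x \<in> carrier R"
  shows "x = \<zero>"
  using assms by (induction n) (auto dest: integral)

lemma (in field) zero_coeffs_if_many_roots:
  assumes p: "set p \<subseteq> carrier R"
    and A: "finite A" "A \<subseteq> {x \<in> carrier R. eval p x = \<zero>}" "length p \<le> card A"
  shows "set p \<subseteq> {\<zero>}"
proof (rule ccontr)
  assume nz: "\<not> set p \<subseteq> {\<zero>}"
  let ?p = "normalize p"
  have "?p \<noteq> []"
  proof
    assume "?p = []"
    then have "p = replicate (length p) \<zero>" using normalize_trick[of p] by simp
    then show False using nz by (metis in_set_replicate singletonI subsetI)
  qed
  have poly: "?p \<in> carrier (poly_ring R)"
    using normalize_gives_polynomial[OF p] univ_poly_carrier by blast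
  have "A \<subseteq> set_mset (roots ?p)"
    using A(2) \<open>?p \<noteq> []\<close> eval_normalize[OF p]
    by (auto simp: roots_mem_iff_is_root[OF poly] is_root_def)
  then have "card A \<le> card (set_mset (roots ?p))" by (simp add: card_mono)
  also have "\<dots> \<le> size (roots ?p)" 
    using sum_mono[of "set_mset (roots ?p)" "\<lambda>_. 1" "count (roots ?p)"]
    by (simp add: size_multiset_overloaded_eq Suc_le_eq)
  also have "\<dots> \<le> degree ?p" by (rule size_roots_le_degree[OF poly])
  also have "\<dots> < length p"
    using \<open>?p \<noteq> []\<close> normalize_length_le[of p] by (cases ?p) auto
  finally show False using A(3) by simp
qed

text \<open>Of the binomial expansion only the degree matters: as a polynomial in x, the correction
  has at most \<open>n\<close> coefficients, few enough for a root count on a set of n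
  elements.\<close>

lemma (in cring) pow_add_expansion:
  assumes y: "y \<in> carrier R"
  shows "\<exists>p. set p \<subseteq> carrier R \<and> length p \<le> n \<and>
    (\<forall>x\<in>carrier R. (x \<oplus> y) [^] n = x [^] n \<oplus> eval p x)"
proof (induction n)
  case 0
  show ?case by (intro exI[of _ "[]"]) simp
next
  case (Suc n)
  then obtain p where p: "set p \<subseteq> carrier R" "length p \<le> n"
    and eq: "\<And>x. x \<in> carrier R \<Longrightarrow> (x \<oplus> y) [^] n = x [^] n \<oplus> eval p x" by blast
  let ?r = "poly_add (p @ [\<zero>]) (poly_add (monom y n) (map ((\<otimes>) y) p))"
  have carr: "set (monom y n) \<subseteq> carrier R" "set (map ((\<otimes>) y) p) \<subseteq> carrier R" "set (p @ [\<zero>]) \<subseteq> carrier R"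
    using y p(1) by (auto simp: monom_def)
  then have carr2: "set (poly_add (monom y n) (map ((\<otimes>) y) p)) \<subseteq> carrier R"
    by (intro poly_add_in_carrier)
  have "length ?r \<le> Suc n"
    using poly_add_length_le[of "p @ [\<zero>]" "poly_add (monom y n) (map ((\<otimes>) y) p)"]
      poly_add_length_le[of "monom y n" "map ((\<otimes>) y) p"] p(2)
    by (simp add: monom_def)
  moreover have "(x \<oplus> y) [^] Suc n = x [^] Suc n \<oplus> eval ?r x" if x: "x \<in> carrier R" for x
  proof -
    have ev: "eval p x \<in> carrier R" by (rule eval_in_carrier[OF p(1) x])
    have "eval ?r x = eval p x \<otimes> x \<oplus> (y \<otimes> x [^] n \<oplus> y \<otimes> eval p x)"
      using eval_append_aux[OF p(1) zero_closed x] ev x y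
      by (simp add: eval_poly_add[OF carr(3) carr2 x] eval_poly_add[OF carr(1,2) x] eval_scale p(1)
          eval_monom)
    then show ?thesis using x y ev by (simp add: eq l_distr r_distr a_ac m_ac)
  qed
  moreover have "set ?r \<subseteq> carrier R" using carr carr2 by (intro poly_add_in_carrier)
  ultimately show ?case by blast
qed

section \<open>Extensions of finite fields and the power map x -> x^q\<close>

locale finite_field_extension = field F for F (structure) +
  fixes k :: "'a set" and f q :: nat
  assumes finite_carrier: "finite (carrier F)"
    and subfield: "subfield k F"
    and dim: "dimension f k (carrier F)"
    and card_base: "card k = q"
begin

lemma base_subset: "k \<subseteq> carrier F" by (rule subfieldE(3)[OF subfield])

lemma base_simps [simp]:
  "x \<in> k \<Longrightarrow> x \<in> carrier F" "\<zero> \<in> k" "\<one> \<in> k"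
  "x \<in> k \<Longrightarrow> y \<in> k \<Longrightarrow> x \<oplus> y \<in> k" "x \<in> k \<Longrightarrow> y \<in> k \<Longrightarrow> x \<otimes> y \<in> k" "x \<in> k \<Longrightarrow> \<ominus> x \<in> k"
  using base_subset subringE[OF subfieldE(1)[OF subfield]] by auto

lemma finite_base: "finite k" using base_subset finite_carrier by (rule finite_subset)

lemma q_ge_2: "2 \<le> q"
proof -
  have "card {\<zero>, \<one>} \<le> card k" by (rule card_mono[OF finite_base]) simp
  then show ?thesis by (simp add: card_base)
qed

lemma card_carrier: "card (carrier F) = q ^ f"
proof -
  obtain us where us: "set us \<subseteq> carrier F" "independent k us" "length us = f" "Span k us = carrier F"
    using exists_base[OF subfield dim] by blast
  have "bij_betw (\<lambda>ks. combine ks us) {ks. set ks \<subseteq> k \<and> length ks = f} (carrier F)"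
    unfolding bij_betw_def
  proof
    show "(\<lambda>ks. combine ks us) ` {ks. set ks \<subseteq> k \<and> length ks = f} = carrier F"
      using Span_eq_combine_set_length_version[OF subfield us(1)] us(3,4) by auto
    show "inj_on (\<lambda>ks. combine ks us) {ks. set ks \<subseteq> k \<and> length ks = f}"
    proof (rule inj_onI, clarsimp)
      fix ks ks' assume ks: "set ks \<subseteq> k" "set ks' \<subseteq> k" "f = length ks" "length ks' = length ks"
        and eq: "combine ks us = combine ks' us"
      have "combine ks us \<in> Span k us"
        using Span_eq_combine_set_length_version[OF subfield us(1)] ks us(3) by auto
      then show "ks = ks'"
        using unique_decomposition[OF subfield us(2)] ks eq us(3) by metis
    qed
  qed
  from bij_betw_same_card[OF this] show ?thesis by (simp add: card_lists_length_eq finite_base card_base)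
qed

lemma base_pow_q:
  assumes "x \<in> k" shows "x [^] q = x"
proof (cases "x = \<zero>")
  case True
  then show ?thesis using q_ge_2 by (simp add: nat_pow_zero)
next
  case False
  interpret K: field "F\<lparr>carrier := k\<rparr>" using subfield_iff(2)[OF subfield] .
  have "Units (F\<lparr>carrier := k\<rparr>) = k - {\<zero>}" using K.field_Units by simp
  then have "x [^]\<^bsub>F\<lparr>carrier := k\<rparr>\<^esub> (q - 1) = \<one>"
    using K.units_power_order_eq_one[of x] False assms finite_base
    by (simp add: card_Diff_singleton card_base)
  then have "x [^] (q - 1) = \<one>" using nat_pow_consistent[of x] by metis
  then have "x [^] Suc (q - 1) = x" using assms by simp
  then show ?thesis using q_ge_2 by simp
qed

text \<open>The difference of both sides is a polynomial of degree less than \<open>q\<close> in \<open>x\<close> that vanishes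
  on \<open>k\<close>. This additivity in one argument from \<open>k\<close> is all that Horner's scheme needs, and it
  avoids identifying \<open>q\<close> as a power of the characteristic.\<close>

lemma pow_q_add_base:
  assumes y: "y \<in> k" and x: "x \<in> carrier F"
  shows "(x \<oplus> y) [^] q = x [^] q \<oplus> y"
proof -
  obtain p where p: "set p \<subseteq> carrier F" "length p \<le> q"
    and eq: "\<And>x. x \<in> carrier F \<Longrightarrow> (x \<oplus> y) [^] q = x [^] q \<oplus> eval p x"
    using pow_add_expansion[of y q] y by auto
  let ?r = "poly_add p [\<ominus> y]"
  have ev: "eval ?r x = eval p x \<oplus> \<ominus> y" if "x \<in> carrier F" for x
    using that y p(1) by (simp add: eval_poly_add)
  have "eval ?r x = \<zero>" if x: "x \<in> k" for x
  proof -
    have "x \<oplus> y = x \<oplus> eval p x"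
      using eq[of x] x y by (simp add: base_pow_q)
    then have "eval p x = y" using x y eval_in_carrier[OF p(1)] by simp
    then show ?thesis using ev[of x] x y by (simp add: r_neg)
  qed
  moreover have "length ?r \<le> card k"
    using poly_add_length_le[of p "[\<ominus> y]"] p(2) q_ge_2 by (simp add: card_base)
  moreover have "set ?r \<subseteq> carrier F" using p(1) y by (intro poly_add_in_carrier) auto
  ultimately have "set ?r \<subseteq> {\<zero>}"
    by (intro zero_coeffs_if_many_roots[OF _ finite_base]) auto
  then have "eval p x \<oplus> \<ominus> y = \<zero>" using eval_zero_coeffs[OF _ x] ev[OF x] by simp
  then have "eval p x = y"
    using minus_equality[of "eval p x" "\<ominus> y"] x y eval_in_carrier[OF p(1) x] by simp
  then show ?thesis using eq[OF x] by simp
qed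

lemma eval_pow_q:
  assumes "set p \<subseteq> k" "x \<in> carrier F"
  shows "eval p (x [^] q) = eval p x [^] q"
  using assms(1)
proof (induction p rule: rev_induct)
  case Nil
  then show ?case using q_ge_2 by (simp add: nat_pow_zero)
next
  case (snoc c p)
  then have c: "c \<in> k" and p: "set p \<subseteq> carrier F" using base_subset by auto
  have "eval p x \<in> carrier F" by (rule eval_in_carrier[OF p assms(2)])
  then show ?case
    using snoc c assms(2) p
    by (simp add: eval_append_aux pow_q_add_base nat_pow_distrib)
qed

lemma eval_pow_q_pow:
  assumes "set p \<subseteq> k" "x \<in> carrier F"
  shows "eval p (x [^] (q ^ i)) = eval p x [^] (q ^ i)"
proof (induction i)
  case 0
  then show ?case using assms base_subset eval_in_carrier[of p x] by simp
next
  case (Suc i)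
  then show ?case
    using eval_pow_q[OF assms(1), of "x [^] (q ^ i)"] assms base_subset eval_in_carrier[of p x]
    by (simp add: nat_pow_pow mult.commute)
qed

lemma order_units: "order (units_of F) = q ^ f - 1"
  using order_mult_of[OF finite_carrier] by (simp add: mult_of_is_Units order_def card_carrier)

lemma card_pos: "1 < q ^ f"
  using card_carrier card_mono[OF finite_carrier, of "{\<zero>, \<one>}"] by simp

lemma f_pos: "0 < f" using card_pos by (cases f) auto


lemma units: "carrier (units_of F) = carrier F - {\<zero>}"
  using field_Units by (simp add: units_of_carrier)

lemma obtain_generator:
  obtains g where "g \<in> carrier F" "g \<noteq> \<zero>" "\<And>x. x \<in> carrier F - {\<zero>} \<Longrightarrow> \<exists>i::nat. x = g [^] i"
proof -
  obtain g where g: "g \<in> carrier (mult_of F)" "carrier (mult_of F) = {g [^] i |i::nat. i \<in> UNIV}"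
    using finite_field_mult_group_has_gen[OF finite_carrier] by auto
  have "\<exists>i::nat. x = g [^] i" if x: "x \<in> carrier F - {\<zero>}" for x
  proof -
    have "x \<in> carrier (mult_of F)" using x by simp
    then show ?thesis unfolding g(2) by blast
  qed
  then show thesis using that[of g] g(1) by simp
qed

end

section \<open>Galois group and norm of an extension of finite fields\<close>

locale finite_field_generator = finite_field_extension +
  fixes g
  assumes gen: "g \<in> carrier F" and gen_nonzero: "g \<noteq> \<zero>"
    and generates: "x \<in> carrier F - {\<zero>} \<Longrightarrow> \<exists>i::nat. x = g [^] i"
begin

lemma ord_gen: "group.ord (units_of F) g = q ^ f - 1"
proof -
  interpret U: comm_group "units_of F" by (rule units_comm_group)
  have g: "g \<in> carrier (units_of F)" using gen gen_nonzero by (simp add: units)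
  have pow: "g [^]\<^bsub>units_of F\<^esub> i = g [^] i" for i :: nat
    using g by (simp add: units_of_pow units_of_carrier)
  have "carrier (units_of F) = {g [^]\<^bsub>units_of F\<^esub> i |i. i \<in> (UNIV::nat set)}"
    unfolding pow using generates g U.nat_pow_closed[OF g] by (auto simp: units pow)
  moreover have "finite (carrier (units_of F))" using finite_carrier by (simp add: units)
  ultimately show ?thesis
    using U.generate_pow_card[OF g] U.generate_pow_on_finite_carrier[OF _ g] order_units
    unfolding order_def by metis
qed

lemma inj_on_conjugates: "inj_on (\<lambda>i. g [^] (q ^ i)) {..<f}"
proof -
  interpret U: comm_group "units_of F" by (rule units_comm_group)
  have g: "g \<in> carrier (units_of F)" using gen gen_nonzero by (simp add: units)
  have pow: "g [^]\<^bsub>units_of F\<^esub> i = g [^] i" for i :: nat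
    using g by (simp add: units_of_pow units_of_carrier)
  \<comment> \<open>The range of exponents is 1..ord rather than 0..<ord: for q^f = 2 the order is
    1, and the exponent q^0 = 1 is only covered by the former.\<close>
  have "q ^ i \<in> {1..q ^ f - 1}" if "i < f" for i
  proof -
    have "q ^ i < q ^ f" using q_ge_2 that by (intro power_strict_increasing) auto
    moreover have "1 \<le> q ^ i" using q_ge_2 by simp
    ultimately show ?thesis by simp
  qed
  then have "inj_on (\<lambda>n. g [^] n) ((\<lambda>i. q ^ i) ` {..<f})"
    using U.ord_inj'[OF g] by (auto simp: ord_gen pow intro: inj_on_subset)
  moreover have "inj_on (\<lambda>i. q ^ i) {..<f}" using q_ge_2 by (intro inj_onI) simp
  ultimately show ?thesis using comp_inj_on[of "\<lambda>i. q ^ i" "{..<f}" "\<lambda>n. g [^] n"] by (simp add: o_def)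
qed

lemma conjugates_are_roots:
  assumes "set p \<subseteq> k" "eval p g = \<zero>"
  shows "eval p (g [^] (q ^ i)) = \<zero>"
  using eval_pow_q_pow[OF assms(1) gen, of i] q_ge_2 assms(2) by (simp add: nat_pow_zero)

text \<open>A root g brings along its f conjugates g^(q^i), which is more roots than a nonzero list
  of length at most f can have. So 1, g, ..., g^(f-1) are independent over k.\<close>

lemma eval_gen_eq_zero:
  assumes "set p \<subseteq> k" "length p \<le> f" "eval p g = \<zero>"
  shows "set p \<subseteq> {\<zero>}"
proof (rule zero_coeffs_if_many_roots)
  show "set p \<subseteq> carrier F" using assms(1) base_subset by auto
  show "(\<lambda>i. g [^] (q ^ i)) ` {..<f} \<subseteq> {x \<in> carrier F. eval p x = \<zero>}"
    using conjugates_are_roots[OF assms(1,3)] gen by auto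
  show "length p \<le> card ((\<lambda>i. g [^] (q ^ i)) ` {..<f})"
    using assms(2) by (simp add: card_image[OF inj_on_conjugates])
qed simp

lemma exists_eval_gen:
  assumes "x \<in> carrier F"
  shows "\<exists>p. set p \<subseteq> k \<and> length p = f \<and> x = eval p g"
  using exists_eval_if_independent_powers[OF subfield gen dim eval_gen_eq_zero assms] .

text \<open>Full additivity is recovered from \<open>pow_q_add_base\<close>: both summands are
  values at g of polynomials over k, and taking values commutes with the q^i-th power.\<close>

lemma pow_q_pow_add:
  assumes "x \<in> carrier F" "y \<in> carrier F"
  shows "(x \<oplus> y) [^] (q ^ i) = x [^] (q ^ i) \<oplus> y [^] (q ^ i)"
proof -
  obtain p r where p: "set p \<subseteq> k" "x = eval p g" and r: "set r \<subseteq> k" "y = eval r g"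
    using exists_eval_gen assms by metis
  have carr: "set p \<subseteq> carrier F" "set r \<subseteq> carrier F" using p r base_subset by auto
  have "set (poly_add p r) \<subseteq> k"
    by (rule polynomial_incl[OF poly_add_is_polynomial[OF subfieldE(1)[OF subfield] p(1) r(1)]])
  from eval_pow_q_pow[OF this gen, of i] show ?thesis
    using eval_pow_q_pow[OF p(1) gen, of i] eval_pow_q_pow[OF r(1) gen, of i] gen
    by (simp add: eval_poly_add[OF carr] p(2) r(2))
qed

text \<open>An automorphism over k is determined by the image of g, which must be a root of a monic
  polynomial of degree f over k vanishing at g. Conversely, a power map is additive with trivial
  kernel, hence bijective on a finite field.\<close>

lemma galois_group_eq:
  "galois_group F k = (\<lambda>i. \<lambda>x\<in>carrier F. x [^] (q ^ i)) ` {..<f}"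
proof (intro equalityI subsetI)
  fix \<sigma> assume "\<sigma> \<in> galois_group F k"
  then have \<sigma>: "\<sigma> \<in> ring_iso F F" "\<sigma> \<in> extensional (carrier F)" "\<And>x. x \<in> k \<Longrightarrow> \<sigma> x = x"
    by (auto simp: galois_group_def)
  interpret \<sigma>: ring_hom_ring F F \<sigma>
    using \<sigma>(1) by (intro ring_hom_ringI2) (auto simp: ring_iso_def ring_axioms)
  have eval_\<sigma>: "\<sigma> (eval p g) = eval p (\<sigma> g)" if "set p \<subseteq> k" for p
  proof -
    have "map \<sigma> p = p" using that \<sigma>(3) by (intro map_idI) auto
    then show ?thesis using \<sigma>.eval_hom'[OF gen, of p] that base_subset by auto
  qed
  obtain c where c: "set c \<subseteq> k" "length c = f" "\<ominus> (g [^] f) = eval c g"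
    using exists_eval_gen[of "\<ominus> (g [^] f)"] gen by auto
  let ?P = "\<one> # c"
  have P: "set ?P \<subseteq> k" "eval ?P g = \<zero>"
    using c(1,2) gen by (auto simp: c(3)[symmetric] r_neg)
  define A where "A = (\<lambda>i. g [^] (q ^ i)) ` {..<f}"
  \<comment> \<open>Otherwise \<open>?P\<close>, with f + 1 coefficients, would have f + 1 roots and
    vanish identically, against its leading coefficient one.\<close>
  have "\<sigma> g \<in> A"
  proof (rule ccontr)
    assume notin: "\<sigma> g \<notin> A"
    have "eval ?P (\<sigma> g) = \<zero>" using eval_\<sigma>[OF P(1)] unfolding P(2) \<sigma>.hom_zero by (rule sym)
    then have "insert (\<sigma> g) A \<subseteq> {x \<in> carrier F. eval ?P x = \<zero>}"
      using conjugates_are_roots[OF P] gen \<sigma>.hom_closed[OF gen] unfolding A_def by blast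
    moreover have "length ?P \<le> card (insert (\<sigma> g) A)"
      using notin c(2) by (simp add: A_def card_image[OF inj_on_conjugates])
    moreover have "set ?P \<subseteq> carrier F" using P(1) base_subset by blast
    ultimately have "set ?P \<subseteq> {\<zero>}"
      by (intro zero_coeffs_if_many_roots[of ?P "insert (\<sigma> g) A"]) (auto simp: A_def)
    then show False by simp
  qed
  then obtain i where i: "i < f" "\<sigma> g = g [^] (q ^ i)" by (auto simp: A_def)
  have "\<sigma> = (\<lambda>x\<in>carrier F. x [^] (q ^ i))"
  proof (rule extensionalityI[OF \<sigma>(2)])
    fix x assume x: "x \<in> carrier F"
    then obtain p where p: "set p \<subseteq> k" "x = eval p g" using exists_eval_gen by blast
    then have "\<sigma> x = x [^] (q ^ i)" using eval_\<sigma> i(2) eval_pow_q_pow[OF _ gen] by simp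
    then show "\<sigma> x = (\<lambda>x\<in>carrier F. x [^] (q ^ i)) x" using x by simp
  qed simp
  then show "\<sigma> \<in> (\<lambda>i. \<lambda>x\<in>carrier F. x [^] (q ^ i)) ` {..<f}" using i(1) by blast
next
  fix \<sigma> assume "\<sigma> \<in> (\<lambda>i. \<lambda>x\<in>carrier F. x [^] (q ^ i)) ` {..<f}"
  then obtain i where \<sigma>: "\<sigma> = (\<lambda>x\<in>carrier F. x [^] (q ^ i))" by blast
  have "\<sigma> \<in> ring_hom F F"
    by (rule ring_hom_memI) (simp_all add: \<sigma> pow_q_pow_add nat_pow_distrib)
  then interpret \<sigma>: ring_hom_ring F F \<sigma> by (intro ring_hom_ringI2 ring_axioms)
  have "a_kernel F F \<sigma> = {\<zero>}"
    using q_ge_2 by (auto simp: a_kernel_def' \<sigma> nat_pow_zero dest: pow_eq_zeroD)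
  then have inj: "inj_on \<sigma> (carrier F)" by (rule \<sigma>.trivial_ker_imp_inj)
  then have "bij_betw \<sigma> (carrier F) (carrier F)"
    using endo_inj_surj[OF finite_carrier _ inj] \<sigma>.hom_closed inj
    by (simp add: bij_betw_def image_subset_iff)
  moreover have "\<sigma> x = x" if "x \<in> k" for x
  proof -
    have "x [^] (q ^ i) = x"
      by (induction i) (use that base_pow_q in \<open>simp_all add: nat_pow_pow[symmetric]\<close>)
    then show ?thesis using that by (simp add: \<sigma>)
  qed
  moreover have "\<sigma> \<in> extensional (carrier F)" by (simp add: \<sigma>)
  ultimately show "\<sigma> \<in> galois_group F k"
    using \<open>\<sigma> \<in> ring_hom F F\<close> by (simp add: galois_group_def ring_iso_def)
qed

lemma galois_norm_eq:
  assumes x: "x \<in> carrier F"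
  shows "galois_norm F k x = x [^] (\<Sum>i<f. q ^ i)"
proof -
  let ?frob = "\<lambda>i. \<lambda>x\<in>carrier F. x [^] (q ^ i)"
  have inj: "inj_on ?frob {..<f}"
  proof (rule inj_onI)
    fix i j assume ij: "i \<in> {..<f}" "j \<in> {..<f}" "?frob i = ?frob j"
    then have "g [^] (q ^ i) = g [^] (q ^ j)" using gen by (metis restrict_apply')
    then show "i = j" using inj_onD[OF inj_on_conjugates] ij by blast
  qed
  have "galois_norm F k x = finprod F (\<lambda>i. ?frob i x) {..<f}"
    unfolding galois_norm_def galois_group_eq using x by (intro finprod_reindex inj) auto
  also have "\<dots> = finprod F (\<lambda>i. x [^] (q ^ i)) {..<f}"
    using x by (intro finprod_cong') auto
  \<comment> \<open>The degree f is fixed by the locale, so the induction runs over a fresh variable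
    that is set equal to it.\<close>
  also have "\<dots> = x [^] (\<Sum>i<n. q ^ i)" if "n = f" for n
    unfolding that[symmetric]
    using x by (induction n) (simp_all add: lessThan_Suc m_comm nat_pow_mult[symmetric])
  finally show ?thesis by simp
qed

end

section \<open>Discrete valuations\<close>

context discretely_valued_field
begin

abbreviation "V \<equiv> val_at_least R v"
abbreviation "Rk \<equiv> residue_field R v"
abbreviation "VR \<equiv> valuation_ring R v"

definition red :: "'a \<Rightarrow> 'a set" where "red x = valuation_ideal R v +>\<^bsub>VR\<^esub> x"

lemma val_one [simp]: "v \<one> = 0"
  using val_mult[of \<one> \<one>] by simp

lemma val_inv:
  assumes "x \<in> carrier R - {\<zero>}" shows "v (inv x) = - v x"
proof -
  have x: "x \<in> Units R" using assms field_Units by simp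
  then have "inv x \<in> carrier R - {\<zero>}" using Units_inv_Units field_Units by auto
  then show ?thesis using val_mult[of x "inv x"] assms x by simp
qed

lemma val_minus_one: "v (\<ominus> \<one>) = 0"
  using val_mult[of "\<ominus> \<one>" "\<ominus> \<one>"] by (simp add: l_minus)

lemma val_minus: "x \<in> carrier R - {\<zero>} \<Longrightarrow> v (\<ominus> x) = v x"
  using val_mult[of "\<ominus> \<one>" x] by (simp add: l_minus val_minus_one)

lemma val_pow:
  assumes "x \<in> carrier R - {\<zero>}"
  shows "x [^] (n::nat) \<noteq> \<zero>" "v (x [^] n) = int n * v x"
proof -
  have "x [^] n \<noteq> \<zero> \<and> v (x [^] n) = int n * v x"
    using assms
    by (induction n) (auto simp: val_mult integral_iff algebra_simps)
  then show "x [^] n \<noteq> \<zero>" "v (x [^] n) = int n * v x" by auto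
qed

lemma mem_V_iff: "x \<in> V n \<longleftrightarrow> x \<in> carrier R \<and> (x = \<zero> \<or> n \<le> v x)"
  by (simp add: val_at_least_def)

lemma V_closed [simp]: "x \<in> V n \<Longrightarrow> x \<in> carrier R" by (simp add: mem_V_iff)

lemma V_zero [simp]: "\<zero> \<in> V n" by (simp add: mem_V_iff)

lemma V_one [simp]: "\<one> \<in> V 0" by (simp add: mem_V_iff)

lemma V_minus [simp]: "x \<in> V n \<Longrightarrow> \<ominus> x \<in> V n"
  by (cases "x = \<zero>") (auto simp: mem_V_iff val_minus)

lemma V_add [simp]:
  assumes "x \<in> V n" "y \<in> V n" shows "x \<oplus> y \<in> V n"
proof (cases "x = \<zero> \<or> y = \<zero> \<or> x \<oplus> y = \<zero>")
  case False
  then show ?thesis using assms val_add[of x y] by (auto simp: mem_V_iff)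
qed (use assms in \<open>auto simp: mem_V_iff\<close>)

lemma V_diff [simp]: "x \<in> V n \<Longrightarrow> y \<in> V n \<Longrightarrow> x \<ominus> y \<in> V n"
  by (simp add: minus_eq)

lemma V_mult:
  assumes "x \<in> V m" "y \<in> V n" shows "x \<otimes> y \<in> V (m + n)"
proof (cases "x = \<zero> \<or> y = \<zero>")
  case False
  then show ?thesis using assms val_mult[of x y] by (auto simp: mem_V_iff)
qed (use assms in \<open>auto simp: mem_V_iff\<close>)

lemma V_mult0 [simp]: "x \<in> V 0 \<Longrightarrow> y \<in> V n \<Longrightarrow> x \<otimes> y \<in> V n" "y \<in> V n \<Longrightarrow> x \<in> V 0 \<Longrightarrow> y \<otimes> x \<in> V n"
  using V_mult[of x 0 y n] V_mult[of y n x 0] by auto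

lemma V_pow [simp]: "x \<in> V 0 \<Longrightarrow> x [^] (n::nat) \<in> V 0"
  by (induction n) auto

lemma V_mono: "x \<in> V n \<Longrightarrow> m \<le> n \<Longrightarrow> x \<in> V m"
  by (auto simp: mem_V_iff)

lemma V_Inter:
  assumes "\<And>n::nat. x \<in> V (int n)" shows "x = \<zero>"
proof (rule ccontr)
  assume "x \<noteq> \<zero>"
  then have "int (nat (v x + 1)) \<le> v x" using assms[of "nat (v x + 1)"] by (simp only: mem_V_iff) simp
  then show False by linarith
qed

lemma V0_subring: "subring (V 0) R"
  by (rule subringI) auto

lemma VR_simps [simp]:
  "carrier VR = V 0" "\<zero>\<^bsub>VR\<^esub> = \<zero>" "\<one>\<^bsub>VR\<^esub> = \<one>" "x \<oplus>\<^bsub>VR\<^esub> y = x \<oplus> y" "x \<otimes>\<^bsub>VR\<^esub> y = x \<otimes> y"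
  by (simp_all add: valuation_ring_def)

sublocale VR: cring VR
  using subcring_iff[OF subringE(1)[OF V0_subring]] subcringI'[OF V0_subring]
  by (simp add: valuation_ring_def)

lemma VR_minus [simp]: "x \<in> V 0 \<Longrightarrow> \<ominus>\<^bsub>VR\<^esub> x = \<ominus> x"
  by (rule VR.minus_equality) (auto simp: l_neg)

lemma V1_ideal: "ideal (valuation_ideal R v) VR"
proof (rule idealI)
  show "subgroup (valuation_ideal R v) (add_monoid VR)"
  proof (rule VR.add.subgroupI)
    show "valuation_ideal R v \<subseteq> carrier VR" by (auto simp: valuation_ideal_def intro: V_mono)
    then show "\<ominus>\<^bsub>VR\<^esub> x \<in> valuation_ideal R v" if "x \<in> valuation_ideal R v" for x
      using that by (auto simp: valuation_ideal_def)
    show "valuation_ideal R v \<noteq> {}" using V_zero[of 1] unfolding valuation_ideal_def by blast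
  qed (auto simp: valuation_ideal_def)
qed (auto simp: VR.ring_axioms valuation_ideal_def)

sublocale I: ideal "valuation_ideal R v" VR by (rule V1_ideal)

sublocale Rk: cring Rk
  using I.quotient_is_cring[OF VR.is_cring] by (simp add: residue_field_def)

sublocale red: ring_hom_cring VR Rk red
  using I.rcos_ring_hom_cring[OF VR.is_cring] by (simp add: residue_field_def red_def[abs_def])

lemma Rk_carrier: "carrier Rk = red ` V 0"
  by (auto simp: residue_field_def FactRing_def A_RCOSETS_def' red_def)

lemma red_zero_iff: "x \<in> V 0 \<Longrightarrow> red x = \<zero>\<^bsub>Rk\<^esub> \<longleftrightarrow> x \<in> V 1"
  using I.rcos_const_imp_mem[of x] I.a_rcos_const[of x]
  by (auto simp: residue_field_def FactRing_def red_def valuation_ideal_def)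

lemma red_closed [simp]: "x \<in> V 0 \<Longrightarrow> red x \<in> carrier Rk"
  by (simp add: Rk_carrier)

lemma red_simps [simp]:
  "x \<in> V 0 \<Longrightarrow> y \<in> V 0 \<Longrightarrow> red (x \<oplus> y) = red x \<oplus>\<^bsub>Rk\<^esub> red y"
  "x \<in> V 0 \<Longrightarrow> y \<in> V 0 \<Longrightarrow> red (x \<otimes> y) = red x \<otimes>\<^bsub>Rk\<^esub> red y"
  "x \<in> V 0 \<Longrightarrow> red (\<ominus> x) = \<ominus>\<^bsub>Rk\<^esub> red x"
  "red \<one> = \<one>\<^bsub>Rk\<^esub>" "red \<zero> = \<zero>\<^bsub>Rk\<^esub>"
  using red.hom_add[of x y] red.hom_mult[of x y] red.hom_a_inv[of x] red.hom_one red.hom_zero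
  by simp_all

lemma red_pow [simp]: "x \<in> V 0 \<Longrightarrow> red (x [^] (n::nat)) = red x [^]\<^bsub>Rk\<^esub> n"
  by (induction n) simp_all

lemma red_eq_iff:
  assumes "x \<in> V 0" "y \<in> V 0"
  shows "red x = red y \<longleftrightarrow> x \<ominus> y \<in> V 1"
proof -
  have "red x = red y \<longleftrightarrow> red (x \<ominus> y) = \<zero>\<^bsub>Rk\<^esub>"
    using assms by (simp add: minus_eq Rk.r_right_minus_eq flip: Rk.minus_eq)
  then show ?thesis using red_zero_iff[of "x \<ominus> y"] assms by simp
qed

text \<open>\<open>teichmueller\<close> expresses lifting as membership in a coset; this translates
  it into the reduction map.\<close>

lemma mem_coset_iff:
  assumes "\<xi> \<in> carrier Rk"
  shows "x \<in> \<xi> \<longleftrightarrow> x \<in> V 0 \<and> red x = \<xi>"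
proof -
  obtain y where y: "y \<in> V 0" "\<xi> = red y" using assms by (auto simp: Rk_carrier)
  show ?thesis
  proof
    assume "x \<in> \<xi>"
    then obtain z where "z \<in> V 1" "x = z \<oplus> y"
      unfolding y(2) red_def a_r_coset_def' by (auto simp: valuation_ideal_def)
    moreover have "z \<in> V 0" if "z \<in> V 1" for z using that V_mono by force
    ultimately show "x \<in> V 0 \<and> red x = \<xi>"
      using y red_zero_iff[of z] by auto
  next
    assume x: "x \<in> V 0 \<and> red x = \<xi>"
    then show "x \<in> \<xi>" using I.a_rcos_self[of x] by (auto simp: red_def)
  qed
qed

lemma unit_iff: "x \<in> V 0 \<Longrightarrow> red x \<noteq> \<zero>\<^bsub>Rk\<^esub> \<longleftrightarrow> x \<noteq> \<zero> \<and> v x = 0"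
  by (auto simp: red_zero_iff mem_V_iff)

lemma residue_field_field: "field Rk"
proof (rule Rk.field_intro2)
  show "\<zero>\<^bsub>Rk\<^esub> \<noteq> \<one>\<^bsub>Rk\<^esub>" using red_zero_iff[of \<one>] by (auto simp: mem_V_iff)
  fix \<xi> assume "\<xi> \<in> carrier Rk - {\<zero>\<^bsub>Rk\<^esub>}"
  then obtain x where x: "x \<in> V 0" "\<xi> = red x" "x \<noteq> \<zero>" "v x = 0"
    using unit_iff by (auto simp: Rk_carrier)
  have x': "x \<in> carrier R - {\<zero>}" using x by simp
  have inv: "inv x \<in> carrier R" "x \<otimes> inv x = \<one>" using x' field_Units by auto
  then have "inv x \<in> V 0" using val_inv[OF x'] x(4) by (simp add: mem_V_iff)
  then have "red x \<otimes>\<^bsub>Rk\<^esub> red (inv x) = \<one>\<^bsub>Rk\<^esub>" "red (inv x) \<in> carrier Rk"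
    using red_simps(2)[of x "inv x"] x(1) inv(2) by simp_all
  then show "\<xi> \<in> Units Rk"
    using x(1,2) Rk.m_comm[of "red x" "red (inv x)"] by (auto simp: Units_def)
qed

sublocale Rk: field Rk by (rule residue_field_field)

end

section \<open>Teichmueller lifts and roots of principal units\<close>

context discretely_valued_field
begin

text \<open>Integrality of both sides is built in, since it makes congruences compatible with
  products and powers.\<close>

definition val_cong :: "int \<Rightarrow> 'a \<Rightarrow> 'a \<Rightarrow> bool"
  where "val_cong n x y \<longleftrightarrow> x \<in> V 0 \<and> y \<in> V 0 \<and> x \<ominus> y \<in> V n"

lemma val_congD: "val_cong n x y \<Longrightarrow> x \<in> V 0" "val_cong n x y \<Longrightarrow> y \<in> V 0"
  by (auto simp: val_cong_def)

lemma val_cong_refl: "x \<in> V 0 \<Longrightarrow> val_cong n x x"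
  unfolding val_cong_def using r_right_minus_eq[of x x] V_zero[of n] V_closed[of x 0] by metis

lemma val_cong_sym:
  assumes "val_cong n x y" shows "val_cong n y x"
proof -
  have "y \<ominus> x = \<ominus> (x \<ominus> y)"
    using assms V_closed[of x 0] V_closed[of y 0] unfolding val_cong_def by algebra
  then show ?thesis using assms by (simp add: val_cong_def)
qed

lemma val_cong_trans:
  assumes "val_cong n x y" "val_cong n y z" shows "val_cong n x z"
proof -
  have "x \<in> carrier R" "y \<in> carrier R" "z \<in> carrier R" using assms val_congD V_closed by blast+
  then have "x \<ominus> z = (x \<ominus> y) \<oplus> (y \<ominus> z)" by algebra
  then show ?thesis using assms by (simp add: val_cong_def)
qed

lemma val_cong_mono: "val_cong n x y \<Longrightarrow> m \<le> n \<Longrightarrow> val_cong m x y"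
  by (auto simp: val_cong_def intro: V_mono)

lemma val_cong_mult:
  assumes "val_cong n x y" "val_cong n x' y'" shows "val_cong n (x \<otimes> x') (y \<otimes> y')"
proof -
  have "x \<in> carrier R" "y \<in> carrier R" "x' \<in> carrier R" "y' \<in> carrier R"
    using assms val_congD V_closed by blast+
  then have "x \<otimes> x' \<ominus> y \<otimes> y' = x \<otimes> (x' \<ominus> y') \<oplus> (x \<ominus> y) \<otimes> y'" by algebra
  then show ?thesis using assms by (simp add: val_cong_def)
qed

lemma val_cong_pow: "val_cong n x y \<Longrightarrow> val_cong n (x [^] (m::nat)) (y [^] m)"
  by (induction m) (auto simp: val_cong_refl val_cong_mult)

lemma val_cong_eqI:
  assumes "\<And>n::nat. val_cong (int n) x y" shows "x = y"
proof -
  have "x \<ominus> y = \<zero>" by (rule V_Inter) (use assms in \<open>simp add: val_cong_def\<close>)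
  moreover have "x \<in> carrier R" "y \<in> carrier R" using assms[of 0] val_congD V_closed by blast+
  ultimately show ?thesis by simp
qed

lemma val_cong_1_iff: "val_cong 1 x y \<longleftrightarrow> x \<in> V 0 \<and> y \<in> V 0 \<and> red x = red y"
  using red_eq_iff[of x y] unfolding val_cong_def by metis

text \<open>The cofactor is the sum of all x^i y^j with i + j = m, and its reduction is the
  derivative of the power function at the common residue. For the exponent Q that derivative
  vanishes, so Q-th powers sharpen congruences.\<close>

lemma pow_diff_factor:
  assumes x: "x \<in> V 0" "y \<in> V 0" "red x = red y"
  shows "\<exists>s\<in>V 0. x [^] Suc m \<ominus> y [^] Suc m = (x \<ominus> y) \<otimes> s \<and> red s = [Suc m] \<cdot>\<^bsub>Rk\<^esub> (red x [^]\<^bsub>Rk\<^esub> m)"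
proof (induction m)
  case 0
  show ?case using x by (intro bexI[of _ \<one>]) simp_all
next
  case (Suc m)
  then obtain s where s: "s \<in> V 0" "x [^] Suc m \<ominus> y [^] Suc m = (x \<ominus> y) \<otimes> s"
    "red s = [Suc m] \<cdot>\<^bsub>Rk\<^esub> (red x [^]\<^bsub>Rk\<^esub> m)" by blast
  let ?s = "s \<otimes> x \<oplus> y [^] Suc m"
  have carr: "x \<in> carrier R" "y \<in> carrier R" "s \<in> carrier R" "x [^] Suc m \<in> carrier R" "y [^] Suc m \<in> carrier R"
    using x s(1) by auto
  have "x [^] Suc (Suc m) \<ominus> y [^] Suc (Suc m) = (x [^] Suc m \<ominus> y [^] Suc m) \<otimes> x \<oplus> (x \<ominus> y) \<otimes> y [^] Suc m"
    unfolding nat_pow_Suc[of _ "Suc m"] using carr by algebra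
  also have "\<dots> = (x \<ominus> y) \<otimes> ?s" unfolding s(2) using carr by algebra
  finally have "x [^] Suc (Suc m) \<ominus> y [^] Suc (Suc m) = (x \<ominus> y) \<otimes> ?s" .
  moreover have "red ?s = [Suc m] \<cdot>\<^bsub>Rk\<^esub> (red x [^]\<^bsub>Rk\<^esub> Suc m) \<oplus>\<^bsub>Rk\<^esub> red x [^]\<^bsub>Rk\<^esub> Suc m"
  proof -
    have "red ?s = red s \<otimes>\<^bsub>Rk\<^esub> red x \<oplus>\<^bsub>Rk\<^esub> red x [^]\<^bsub>Rk\<^esub> Suc m"
      using s(1) x by simp
    then show ?thesis
      unfolding s(3) using x(1) Rk.add_pow_ldistr[of "red x [^]\<^bsub>Rk\<^esub> m" "red x" "Suc m"] by simp
  qed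
  ultimately show ?case using x s(1) by (intro bexI[of _ ?s]) simp_all
qed

end

section \<open>Limits of iterated Q-th powers in a complete field\<close>

context local_field
begin

abbreviation "Q \<equiv> card (carrier Rk)"

lemma Q_ge_2: "2 \<le> Q"
  using card_mono[OF finite_residue_field, of "{\<zero>\<^bsub>Rk\<^esub>, \<one>\<^bsub>Rk\<^esub>}"] by simp

lemma residue_pow_Q:
  assumes "x \<in> carrier Rk" shows "x [^]\<^bsub>Rk\<^esub> Q = x"
proof (cases "x = \<zero>\<^bsub>Rk\<^esub>")
  case True
  then show ?thesis using Q_ge_2 by (simp add: Rk.nat_pow_zero)
next
  case False
  have "card (Units Rk) = Q - 1" "finite (Units Rk)"
    using finite_residue_field by (simp_all add: Rk.field_Units card_Diff_singleton)
  then have "x [^]\<^bsub>Rk\<^esub> (Q - 1) = \<one>\<^bsub>Rk\<^esub>"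
    using Rk.units_power_order_eq_one[of x] False assms by (simp add: Rk.field_Units)
  then have "x [^]\<^bsub>Rk\<^esub> Suc (Q - 1) = x" using assms by simp
  then show ?thesis using Q_ge_2 by simp
qed

lemma val_cong_pow_Q:
  assumes "val_cong n x y" "1 \<le> n" shows "val_cong (n + 1) (x [^] Q) (y [^] Q)"
proof -
  have x: "x \<in> V 0" "y \<in> V 0" "red x = red y" using val_cong_mono[OF assms] by (auto simp: val_cong_1_iff)
  obtain m where m: "Q = Suc m" using Q_ge_2 by (cases Q) auto
  obtain s where s: "s \<in> V 0" "x [^] Q \<ominus> y [^] Q = (x \<ominus> y) \<otimes> s"
    "red s = [Q] \<cdot>\<^bsub>Rk\<^esub> (red x [^]\<^bsub>Rk\<^esub> m)"
    using pow_diff_factor[OF x, of m] unfolding m by blast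
  \<comment> \<open>Lagrange in the additive group of the residue field, whose order is Q.\<close>
  have "[Q] \<cdot>\<^bsub>Rk\<^esub> a = \<zero>\<^bsub>Rk\<^esub>" if "a \<in> carrier Rk" for a
    using Rk.add.pow_order_eq_1[of a] that by (simp add: add_pow_def order_def)
  then have "s \<in> V 1" using s x by (simp add: red_zero_iff[symmetric])
  then show ?thesis
    using V_mult[of "x \<ominus> y" n s 1] s(2) x assms(1) by (simp add: val_cong_def)
qed

lemma val_cong_pow_Q_pow: "val_cong 1 x y \<Longrightarrow> val_cong (int n + 1) (x [^] (Q ^ n)) (y [^] (Q ^ n))"
proof (induction n)
  case 0
  then have "x \<in> carrier R" "y \<in> carrier R" using val_congD V_closed by blast+
  then show ?case using 0 by simp
next
  case (Suc n)
  then have xy: "x \<in> carrier R" "y \<in> carrier R" using val_congD V_closed by blast+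
  have "val_cong (int n + 1 + 1) ((x [^] (Q ^ n)) [^] Q) ((y [^] (Q ^ n)) [^] Q)"
    by (rule val_cong_pow_Q) (use Suc in auto)
  then show ?case using xy by (simp add: nat_pow_pow mult.commute add.commute)
qed

lemma val_cong_limit:
  assumes s: "\<And>n. val_cong (int n + 1) (s (Suc n)) (s n)"
  shows "\<exists>l. \<forall>n. val_cong (int n + 1) l (s n)"
proof -
  have s0: "s n \<in> V 0" for n using val_congD(2)[OF s] .
  have step: "val_cong (int n + 1) (s (n + k)) (s n)" for n k
  proof (induction k)
    case (Suc k)
    have "val_cong (int n + 1) (s (Suc (n + k))) (s (n + k))" by (rule val_cong_mono[OF s]) simp
    then show ?case using val_cong_trans[OF _ Suc] by simp
  qed (simp add: val_cong_refl s0)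
  have "val_Cauchy R v s"
    unfolding val_Cauchy_def
  proof (intro allI exI impI)
    fix N m n assume mn: "nat N \<le> m" "nat N \<le> n"
    have "val_cong (int (nat N) + 1) (s i) (s (nat N))" if "nat N \<le> i" for i
      using step[of "nat N" "i - nat N"] that by simp
    then have "val_cong (int (nat N) + 1) (s m) (s n)" using mn val_cong_trans val_cong_sym by blast
    then show "s m \<ominus> s n \<in> V N" by (auto simp: val_cong_def elim: V_mono)
  qed
  then obtain l where l: "l \<in> carrier R" "val_tendsto R v s l"
    using complete[of s] s0 V_closed by blast
  have "val_cong (int n + 1) l (s n)" for n
  proof -
    obtain n0 where n0: "\<And>i. n0 \<le> i \<Longrightarrow> s i \<ominus> l \<in> V (int n + 1)"
      using l(2) unfolding val_tendsto_def by blast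
    \<comment> \<open>An index past both thresholds: \<open>s i\<close> is close to the limit and
      congruent to \<open>s n\<close>.\<close>
    define i where "i = n + n0"
    have i: "s i \<ominus> l \<in> V (int n + 1)" using n0 by (simp add: i_def)
    have "s i \<in> carrier R" using s0 V_closed by blast
    then have "l = s i \<ominus> (s i \<ominus> l)" using l(1) by algebra
    moreover have "s i \<ominus> l \<in> V 0" using i by (rule V_mono) simp
    ultimately have "l \<in> V 0" using s0[of i] by (metis V_diff)
    then have "val_cong (int n + 1) (s i) l" using i s0 by (simp add: val_cong_def)
    moreover have "val_cong (int n + 1) (s i) (s n)" using step[of n n0] by (simp add: i_def)
    ultimately show ?thesis using val_cong_trans val_cong_sym by blast
  qed
  then show ?thesis by blast
qed

text \<open>Raising to the power Q^n fixes both elements, yet improves their congruence to level n +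
  1 for every n.\<close>

lemma teichmueller_lift_unique:
  assumes "val_cong 1 x y" "x [^] Q = x" "y [^] Q = y"
  shows "x = y"
proof (rule val_cong_eqI)
  fix n :: nat
  have "x [^] (Q ^ n) = x \<and> y [^] (Q ^ n) = y"
  proof (induction n)
    case (Suc n)
    have "x \<in> carrier R" "y \<in> carrier R" using assms(1) val_congD V_closed by blast+
    then show ?case
      using Suc assms(2,3) nat_pow_pow[of x "Q ^ n" Q] nat_pow_pow[of y "Q ^ n" Q] by (simp add: mult.commute)
  qed (use val_congD[OF assms(1)] in simp)
  then show "val_cong (int n) x y" using val_cong_pow_Q_pow[OF assms(1), of n] val_cong_mono by force
qed

text \<open>The lift is the limit of x^(Q^n) for any integral x above \<xi>. The powers converge
  because x^Q and x have the same residue, and each further Q-th power gains one in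
  valuation.\<close>

lemma exists_teichmueller_lift:
  assumes "\<xi> \<in> carrier Rk"
  shows "\<exists>t\<in>V 0. red t = \<xi> \<and> t [^] Q = t"
proof -
  obtain x where x: "x \<in> V 0" "\<xi> = red x" using assms by (auto simp: Rk_carrier)
  define s where "s = (\<lambda>n. x [^] (Q ^ n))"
  have s0: "s n \<in> V 0" for n using x by (simp add: s_def)
  have s_Suc: "s (Suc n) = s n [^] Q" for n
    using x by (simp add: s_def nat_pow_pow mult.commute)
  have "val_cong 1 (x [^] Q) x" using x residue_pow_Q by (simp add: val_cong_1_iff)
  then have "val_cong (int n + 1) ((x [^] Q) [^] (Q ^ n)) (x [^] (Q ^ n))" for n
    by (rule val_cong_pow_Q_pow)
  then have "val_cong (int n + 1) (s (Suc n)) (s n)" for n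
    using x by (simp add: s_def nat_pow_pow)
  then obtain l where l: "\<And>n. val_cong (int n + 1) l (s n)" using val_cong_limit[of s] by blast
  have "l [^] Q = l"
  proof (rule val_cong_eqI)
    fix n :: nat
    have "val_cong (int n + 1) (l [^] Q) (s (Suc n))" unfolding s_Suc by (rule val_cong_pow[OF l])
    moreover have "val_cong (int n + 1) l (s (Suc n))" using l[of "Suc n"] by (rule val_cong_mono) simp
    ultimately have "val_cong (int n + 1) (l [^] Q) l" using val_cong_trans val_cong_sym by blast
    then show "val_cong (int n) (l [^] Q) l" by (rule val_cong_mono) simp
  qed
  moreover have "val_cong 1 l x" using l[of 0] x by (simp add: s_def)
  ultimately show ?thesis using x by (auto simp: val_cong_1_iff)
qed

lemma teichmueller_eqI:
  assumes "t \<in> V 0" "t [^] Q = t" shows "teichmueller R v (red t) = t"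
  unfolding teichmueller_def
proof (rule the_equality)
  show "t \<in> red t \<and> t [^] Q = t" using assms by (simp add: mem_coset_iff)
  show "x = t" if "x \<in> red t \<and> x [^] Q = x" for x
    by (rule teichmueller_lift_unique) (use that assms in \<open>auto simp: mem_coset_iff val_cong_1_iff\<close>)
qed

lemma teichmueller:
  assumes "\<xi> \<in> carrier Rk"
  shows "teichmueller R v \<xi> \<in> V 0" "red (teichmueller R v \<xi>) = \<xi>" "teichmueller R v \<xi> [^] Q = teichmueller R v \<xi>"
proof -
  obtain t where "t \<in> V 0" "red t = \<xi>" "t [^] Q = t" using exists_teichmueller_lift[OF assms] by blast
  then show "teichmueller R v \<xi> \<in> V 0" "red (teichmueller R v \<xi>) = \<xi>"
    "teichmueller R v \<xi> [^] Q = teichmueller R v \<xi>" using teichmueller_eqI[of t] by auto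
qed

text \<open>With \<open>Q = 1 + e * m\<close>, the powers of \<open>u\<close> with exponent \<open>(Q ^ n - 1) / e\<close> converge to an
  inverse of an \<open>e\<close>-th root of \<open>u\<close>.\<close>

lemma one_unit_root:
  assumes u: "u \<in> V 0" "red u = \<one>\<^bsub>Rk\<^esub>" and m: "Q = Suc (e * m)"
  shows "\<exists>y\<in>V 0. red y = \<one>\<^bsub>Rk\<^esub> \<and> y [^] e = u"
proof -
  define c where "c = (\<lambda>n. \<Sum>i<n. m * Q ^ i)"
  have c: "Suc (e * c n) = Q ^ n" for n
  proof (induction n)
    case (Suc n)
    have "Suc (e * c (Suc n)) = Suc (e * c n) + e * m * Q ^ n" by (simp add: c_def algebra_simps)
    also have "\<dots> = Suc (e * m) * Q ^ n" by (simp add: Suc)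
    finally show ?case by (simp flip: m)
  qed (simp add: c_def)
  define s where "s = (\<lambda>n. u [^] c n)"
  have s0: "s n \<in> V 0" for n using u by (simp add: s_def)
  have u1: "val_cong (int n + 1) (u [^] (Q ^ n)) \<one>" for n
    using val_cong_pow_Q_pow[of u \<one> n] u by (simp add: val_cong_1_iff)
  have "val_cong (int n + 1) (s (Suc n)) (s n)" for n
  proof -
    have "s (Suc n) = s n \<otimes> (u [^] (Q ^ n)) [^] m"
      using u by (simp add: s_def c_def nat_pow_mult nat_pow_pow mult.commute)
    moreover have "val_cong (int n + 1) (s n \<otimes> (u [^] (Q ^ n)) [^] m) (s n \<otimes> \<one> [^] m)"
      by (intro val_cong_mult val_cong_pow u1 val_cong_refl s0)
    moreover have "s n \<in> carrier R" using s0 V_closed by blast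
    ultimately show ?thesis by simp
  qed
  then obtain l where l: "\<And>n. val_cong (int n + 1) l (s n)" using val_cong_limit[of s] by blast
  have l0: "l \<in> V 0" using val_congD(1)[OF l] .
  \<comment> \<open>Here \<open>u * s n ^ e\<close> has exponent 1 + e * c n = Q^n, and u^(Q^n)
    tends to one because u is a principal unit.\<close>
  have "u \<otimes> l [^] e = \<one>"
  proof (rule val_cong_eqI)
    fix n :: nat
    have "val_cong (int n + 1) (u \<otimes> l [^] e) (u \<otimes> s n [^] e)"
      by (intro val_cong_mult val_cong_pow l val_cong_refl u)
    moreover have "u \<otimes> s n [^] e = u [^] (Q ^ n)"
      using u by (simp add: s_def nat_pow_pow m_comm mult.commute flip: c)
    ultimately have "val_cong (int n + 1) (u \<otimes> l [^] e) \<one>" using u1[of n] val_cong_trans by simp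
    then show "val_cong (int n) (u \<otimes> l [^] e) \<one>" by (rule val_cong_mono) simp
  qed
  have "red l = \<one>\<^bsub>Rk\<^esub>" using l[of 0] by (simp add: val_cong_1_iff s_def c_def)
  then have l': "l \<in> carrier R - {\<zero>}" "v l = 0" using unit_iff[OF l0] l0 by auto
  then have inv: "inv l \<in> V 0" "l \<otimes> inv l = \<one>" "inv l \<in> carrier R"
    using val_inv[OF l'(1)] field_Units by (auto simp: mem_V_iff)
  have "red (inv l) = \<one>\<^bsub>Rk\<^esub>"
    using red_simps(2)[OF l0 inv(1)] inv \<open>red l = \<one>\<^bsub>Rk\<^esub>\<close> by simp
  moreover have "inv l [^] e = u"
  proof -
    have "l [^] e \<otimes> inv l [^] e = \<one>" using inv l' by (simp flip: nat_pow_distrib)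
    then have "u \<otimes> (l [^] e \<otimes> inv l [^] e) = u" using u by simp
    then show ?thesis using \<open>u \<otimes> l [^] e = \<one>\<close> u l' inv by (simp flip: m_assoc)
  qed
  ultimately show ?thesis using inv(1) by blast
qed

end

section \<open>Lifting the Frobenius automorphism\<close>

lemma card_image_cong_fibres:
  assumes "\<And>x y. x \<in> A \<Longrightarrow> y \<in> A \<Longrightarrow> f x = f y \<longleftrightarrow> g x = g y"
  shows "card (f ` A) = card (g ` A)"
proof -
  define h where "h \<xi> = g (inv_into A f \<xi>)" for \<xi>
  have h: "h (f x) = g x" if "x \<in> A" for x
    using assms[of "inv_into A f (f x)" x] that by (simp add: h_def f_inv_into_f inv_into_into)
  have "inj_on h (f ` A)"
    using assms h by (auto simp: inj_on_def)
  moreover have "h ` f ` A = g ` A" by (auto simp: image_image h)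
  ultimately show ?thesis by (metis card_image)
qed

context unramified_extension
begin

abbreviation "residue_base \<equiv> residue_subfield L w K"

lemma K_simps [simp]:
  "x \<in> K \<Longrightarrow> x \<in> carrier L" "\<zero> \<in> K" "\<one> \<in> K"
  "x \<in> K \<Longrightarrow> y \<in> K \<Longrightarrow> x \<oplus> y \<in> K" "x \<in> K \<Longrightarrow> y \<in> K \<Longrightarrow> x \<otimes> y \<in> K" "x \<in> K \<Longrightarrow> \<ominus> x \<in> K"
  using subfieldE(3)[OF subfield] subringE[OF subfieldE(1)[OF subfield]] by auto

lemma K_inv: "x \<in> K \<Longrightarrow> x \<noteq> \<zero> \<Longrightarrow> inv x \<in> K"
  using subfield_m_inv(1)[OF subfield, of x] by simp

lemma K_subring: "subring K L" by (rule subfieldE(1)[OF subfield])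

lemma residue_base_eq: "residue_base = red ` (K \<inter> V 0)"
  by (simp add: residue_subfield_def red_def[abs_def])

lemma w_base: "x \<in> K \<Longrightarrow> x \<noteq> \<zero> \<Longrightarrow> \<exists>r::nat. 0 < r \<and> w x = int r * v x"
  using prolongs by auto

text \<open>So far w = r v on K with r unknown. Scaling by a positive integer preserves the
  conditions >= 0 and >= 1, which suffices for the valuation ring and its maximal ideal.\<close>

lemma val_at_least_base: "0 \<le> n \<Longrightarrow> n \<le> 1 \<Longrightarrow> val_at_least (L\<lparr>carrier := K\<rparr>) v n = K \<inter> V n"
proof -
  assume n: "0 \<le> n" "n \<le> 1"
  have iff: "n \<le> v x \<longleftrightarrow> n \<le> w x" if x: "x \<in> K" "x \<noteq> \<zero>" for x
  proof -
    obtain r :: nat where r: "0 < r" "w x = int r * v x" using w_base[OF x] by blast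
    have "0 \<le> v x \<longleftrightarrow> 0 \<le> int r * v x" using r(1) by (simp add: zero_le_mult_iff)
    moreover have "1 \<le> v x \<longleftrightarrow> 1 \<le> int r * v x"
      using zero_less_mult_iff[of "int r" "v x"] r(1) by (simp add: int_one_le_iff_zero_less)
    moreover have "n = 0 \<or> n = 1" using n by auto
    ultimately show ?thesis unfolding r(2) by auto
  qed
  have mem: "x \<in> val_at_least (L\<lparr>carrier := K\<rparr>) v n \<longleftrightarrow> x \<in> K \<inter> V n" for x
  proof (cases "x \<in> K \<and> x \<noteq> \<zero>")
    case True
    then have "n \<le> v x \<longleftrightarrow> n \<le> w x" using iff by blast
    then show ?thesis using True unfolding val_at_least_def by auto
  next
    case False
    then consider "x \<notin> K" | "x = \<zero>" by blast
    then show ?thesis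
    proof cases
      case 1
      then show ?thesis unfolding val_at_least_def by simp
    next
      case 2
      then show ?thesis unfolding val_at_least_def by simp
    qed
  qed
  show ?thesis by (rule Set.set_eqI) (rule mem)
qed

text \<open>Cosets formed in K and cosets formed in L are different sets, but the two reduction maps
  identify the same pairs of integers of K, since the maximal ideal of K is the trace on K of that
  of L.\<close>

lemma card_residue_base: "card residue_base = card (carrier (residue_field (L\<lparr>carrier := K\<rparr>) v))"
proof -
  interpret B: local_field "L\<lparr>carrier := K\<rparr>" v by (rule base_local_field)
  have V: "B.V 0 = K \<inter> V 0" "B.V 1 = K \<inter> V 1" by (simp_all add: val_at_least_base)
  have minus: "x \<ominus>\<^bsub>L\<lparr>carrier := K\<rparr>\<^esub> y = x \<ominus> y" if "x \<in> K" "y \<in> K" for x y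
  proof -
    have "\<ominus>\<^bsub>L\<lparr>carrier := K\<rparr>\<^esub> y = \<ominus> y"
      by (rule B.minus_equality) (use that in \<open>simp_all add: l_neg\<close>)
    then show ?thesis by (simp add: a_minus_def)
  qed
  have iff: "B.red x = B.red y \<longleftrightarrow> red x = red y" if "x \<in> K \<inter> V 0" "y \<in> K \<inter> V 0" for x y
    using that B.red_eq_iff[of x y] red_eq_iff[of x y] by (simp add: V minus minus_eq)
  then have "card (B.red ` (K \<inter> V 0)) = card (red ` (K \<inter> V 0))" by (rule card_image_cong_fibres)
  then show ?thesis unfolding residue_base_eq B.Rk_carrier V by simp
qed

lemma residue_base_subfield: "subfield residue_base Rk"
proof (rule Rk.subfieldI')
  show "subring residue_base Rk"
    unfolding residue_base_eq
  proof (rule Rk.subringI)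
    show "\<one>\<^bsub>Rk\<^esub> \<in> red ` (K \<inter> V 0)" by (rule image_eqI[of _ _ \<one>]) simp_all
    show "\<ominus>\<^bsub>Rk\<^esub> h \<in> red ` (K \<inter> V 0)" if h: "h \<in> red ` (K \<inter> V 0)" for h
    proof -
      obtain x where "x \<in> K \<inter> V 0" "h = red x" using h by blast
      then show ?thesis by (intro image_eqI[of _ _ "\<ominus> x"]) simp_all
    qed
    fix h h' assume "h \<in> red ` (K \<inter> V 0)" "h' \<in> red ` (K \<inter> V 0)"
    then obtain x y where xy: "x \<in> K \<inter> V 0" "h = red x" "y \<in> K \<inter> V 0" "h' = red y" by blast
    show "h \<otimes>\<^bsub>Rk\<^esub> h' \<in> red ` (K \<inter> V 0)"
      by (rule image_eqI[of _ _ "x \<otimes> y"]) (use xy in simp_all)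
    show "h \<oplus>\<^bsub>Rk\<^esub> h' \<in> red ` (K \<inter> V 0)"
      by (rule image_eqI[of _ _ "x \<oplus> y"]) (use xy in simp_all)
  qed auto
  fix h assume "h \<in> residue_base - {\<zero>\<^bsub>Rk\<^esub>}"
  then obtain x where x: "x \<in> K" "x \<in> V 0" "h = red x" "x \<noteq> \<zero>" "w x = 0"
    using unit_iff by (auto simp: residue_base_eq)
  have inv: "inv x \<in> K" "x \<otimes> inv x = \<one>" "inv x \<in> V 0"
    using x K_inv[of x] val_inv[of x] field_Units by (auto simp: mem_V_iff)
  have "red (inv x) \<otimes>\<^bsub>Rk\<^esub> red x = \<one>\<^bsub>Rk\<^esub>"
    using red_simps(2)[of "inv x" x] x inv by (simp add: m_comm)
  then have "inv\<^bsub>Rk\<^esub> h = red (inv x)"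
    using x inv Rk.m_comm[of "red x" "red (inv x)"] by (intro Rk.comm_inv_char) simp_all
  then show "inv\<^bsub>Rk\<^esub> h \<in> residue_base" using inv by (auto simp: residue_base_eq)
qed

sublocale l: finite_field_extension Rk residue_base f "card residue_base"
  by (rule finite_field_extension.intro[OF residue_field_field], rule finite_field_extension_axioms.intro)
    (rule finite_residue_field residue_base_subfield residue_degree refl)+

abbreviation "q \<equiv> card residue_base"

end

section \<open>The power basis of a Teichmueller lift\<close>

locale unramified_extension_generator = unramified_extension +
  fixes g
  assumes g: "g \<in> carrier Rk" "g \<noteq> \<zero>\<^bsub>Rk\<^esub>"
    and g_generates: "\<xi> \<in> carrier Rk - {\<zero>\<^bsub>Rk\<^esub>} \<Longrightarrow> \<exists>i::nat. \<xi> = g [^]\<^bsub>Rk\<^esub> i"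
begin

sublocale l: finite_field_generator Rk residue_base f "card residue_base" g
  by (rule finite_field_generator.intro[OF l.finite_field_extension_axioms], rule finite_field_generator_axioms.intro)
    (rule g | erule g_generates)+

definition "\<zeta> = teichmueller L w g"

lemma \<zeta>: "\<zeta> \<in> V 0" "red \<zeta> = g" "\<zeta> [^] Q = \<zeta>" "\<zeta> \<in> carrier L"
  using teichmueller[OF g(1)] V_closed by (auto simp: \<zeta>_def)

lemma V0_eval [simp]: "set p \<subseteq> V 0 \<Longrightarrow> x \<in> V 0 \<Longrightarrow> eval p x \<in> V 0"
  by (induction p) auto

lemma red_eval:
  assumes "set p \<subseteq> V 0" "x \<in> V 0"
  shows "red (eval p x) = Rk.eval (map red p) (red x)"
  using assms by (induction p) auto

lemma red_K: "set p \<subseteq> K \<inter> V 0 \<Longrightarrow> set (map red p) \<subseteq> residue_base"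
  by (auto simp: residue_base_eq)

text \<open>The powers of \<open>\<zeta>\<close> lift a basis of the residue extension, so no cancellation occurs in a
  linear combination.\<close>

lemma val_eval_\<zeta>:
  assumes p: "set p \<subseteq> K" "length p \<le> f" "\<not> set p \<subseteq> {\<zero>}"
  shows "\<exists>a\<in>set p. a \<noteq> \<zero> \<and> set p \<subseteq> V (w a) \<and> eval p \<zeta> \<noteq> \<zero> \<and> w (eval p \<zeta>) = w a"
proof -
  let ?S = "{c \<in> set p. c \<noteq> \<zero>}"
  have S: "finite ?S" "?S \<noteq> {}" using p(3) by auto
  have "Min (w ` ?S) \<in> w ` ?S" using S by (intro Min_in) simp_all
  then obtain a where a: "a \<in> ?S" "w a = Min (w ` ?S)" by (metis (no_types, lifting) imageE)
  have a_min: "w a \<le> w c" if "c \<in> ?S" for c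
    unfolding a(2) using S(1) that by (intro Min_le finite_imageI imageI)
  have aK: "a \<in> K" "a \<noteq> \<zero>" "a \<in> carrier L" using a(1) p(1) by auto
  have pV: "set p \<subseteq> V (w a)"
  proof
    fix c assume "c \<in> set p"
    then show "c \<in> V (w a)" using a_min[of c] subsetD[OF p(1)] unfolding mem_V_iff by auto
  qed
  have inv: "inv a \<in> K" "inv a \<otimes> a = \<one>" "a \<otimes> inv a = \<one>" "inv a \<in> carrier L"
    using aK K_inv[of a] field_Units by auto
  have invV: "inv a \<in> V (- w a)" using val_inv[of a] aK inv by (simp add: mem_V_iff)
  \<comment> \<open>Division by a coefficient of least valuation makes all coefficients integral and
    one of them equal to one. The reduced list is then not all zero, and the independence of the
    powers of g applies.\<close>
  let ?p = "map ((\<otimes>) (inv a)) p"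
  have p': "set ?p \<subseteq> K \<inter> V 0"
    using pV V_mult[OF invV, of _ "w a"] inv p(1) by auto
  have pC: "set p \<subseteq> carrier L" using p(1) by auto
  have ev: "eval p \<zeta> \<in> carrier L" by (rule eval_in_carrier[OF pC \<zeta>(4)])
  have eq: "eval ?p \<zeta> = inv a \<otimes> eval p \<zeta>" by (rule eval_scale[OF inv(4) pC \<zeta>(4)])
  have "red (eval ?p \<zeta>) \<noteq> \<zero>\<^bsub>Rk\<^esub>"
  proof
    assume "red (eval ?p \<zeta>) = \<zero>\<^bsub>Rk\<^esub>"
    then have "Rk.eval (map red ?p) g = \<zero>\<^bsub>Rk\<^esub>"
      using red_eval[of ?p \<zeta>] p' \<zeta>(1,2) by simp
    then have "set (map red ?p) \<subseteq> {\<zero>\<^bsub>Rk\<^esub>}"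
      using l.eval_gen_eq_zero[OF red_K[OF p']] p(2) by simp
    moreover have "red (inv a \<otimes> a) \<in> set (map red ?p)" using a(1) by auto
    ultimately have "red (inv a \<otimes> a) = \<zero>\<^bsub>Rk\<^esub>" by blast
    then show False using inv by simp
  qed
  moreover have "eval ?p \<zeta> \<in> V 0" using p' \<zeta>(1) by (intro V0_eval) auto
  ultimately have u: "inv a \<otimes> eval p \<zeta> \<noteq> \<zero>" "w (inv a \<otimes> eval p \<zeta>) = 0"
    using unit_iff[of "eval ?p \<zeta>"] unfolding eq by auto
  then have nz: "eval p \<zeta> \<noteq> \<zero>" using inv by auto
  have "inv a \<noteq> \<zero>" using u ev by auto
  then have "w (eval p \<zeta>) = w a"
    using u(2) val_mult[of "inv a" "eval p \<zeta>"] val_inv[of a] nz ev inv aK by simp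
  then show ?thesis using a(1) pV nz by blast
qed

lemma eval_\<zeta>_eq_zero:
  "set p \<subseteq> K \<Longrightarrow> length p \<le> f \<Longrightarrow> eval p \<zeta> = \<zero> \<Longrightarrow> set p \<subseteq> {\<zero>}"
  using val_eval_\<zeta>[of p] by blast

lemma exists_eval_\<zeta>: "x \<in> carrier L \<Longrightarrow> \<exists>p. set p \<subseteq> K \<and> length p = f \<and> x = eval p \<zeta>"
  by (rule exists_eval_if_independent_powers[OF subfield \<zeta>(4) degree eval_\<zeta>_eq_zero])

text \<open>The valuation of a value is the least one among its coefficients, so an integral value
  forces integral coefficients.\<close>

lemma exists_eval_\<zeta>_integral:
  assumes "x \<in> V 0"
  shows "\<exists>p. set p \<subseteq> K \<inter> V 0 \<and> length p = f \<and> x = eval p \<zeta>"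
proof -
  obtain p where p: "set p \<subseteq> K" "length p = f" "x = eval p \<zeta>"
    using exists_eval_\<zeta>[of x] assms by auto
  have "set p \<subseteq> V 0"
  proof (cases "set p \<subseteq> {\<zero>}")
    case False
    then obtain a where "set p \<subseteq> V (w a)" "w x = w a" "x \<noteq> \<zero>"
      using val_eval_\<zeta>[OF p(1)] p(2,3) by auto
    then show ?thesis using assms V_mono[of _ "w a" 0] by (auto simp: mem_V_iff)
  qed auto
  then show ?thesis using p by blast
qed

text \<open>By \<open>val_eval_\<zeta>\<close> every value of w on nonzero elements is already
  attained on K, in particular 1, so r divides 1. Uniformisers of K thereby have valuation one in
  L.\<close>

lemma prolongs_exactly: assumes "x \<in> K - {\<zero>}" shows "w x = v x"
proof -
  obtain r :: nat where r: "0 < r" "\<And>x. x \<in> K - {\<zero>} \<Longrightarrow> w x = int r * v x" using prolongs by blast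
  obtain y where y: "y \<in> carrier L - {\<zero>}" "w y = 1"
    using val_surj by (metis UNIV_I image_iff)
  then obtain p where p: "set p \<subseteq> K" "length p = f" "y = eval p \<zeta>" using exists_eval_\<zeta> by blast
  have "\<not> set p \<subseteq> {\<zero>}" using eval_zero_coeffs[OF _ \<zeta>(4), of p] p(3) y by auto
  then obtain a where "a \<in> set p" "a \<noteq> \<zero>" "w y = w a" using val_eval_\<zeta>[OF p(1)] p(2,3) by auto
  then have "int r * v a = 1" using r(2)[of a] y(2) p(1) by auto
  then have "r = 1" using pos_zmult_eq_1_iff[of "int r" "v a"] r(1) by simp
  then show ?thesis using r(2)[OF assms] by simp
qed

lemma \<zeta>_pow_q: "\<zeta> [^] q \<in> V 0" "red (\<zeta> [^] q) = g [^]\<^bsub>Rk\<^esub> q" "(\<zeta> [^] q) [^] Q = \<zeta> [^] q"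
proof -
  show "\<zeta> [^] q \<in> V 0" "red (\<zeta> [^] q) = g [^]\<^bsub>Rk\<^esub> q" using \<zeta> by simp_all
  have "(\<zeta> [^] q) [^] Q = (\<zeta> [^] Q) [^] q" using \<zeta>(4) by (simp add: nat_pow_pow mult.commute)
  then show "(\<zeta> [^] q) [^] Q = \<zeta> [^] q" by (simp add: \<zeta>(3))
qed

lemma Q_eq: "Q = q ^ f" by (rule l.card_carrier)

text \<open>\<open>P\<close> is the minimal polynomial of \<open>\<zeta>\<close> and \<open>X ^ Q - X = P * R\<close>. Since \<open>\<zeta>\<close> is a simple root
  modulo the maximal ideal, \<open>R\<close> is a unit at \<open>\<zeta>\<close>, hence also at \<open>\<zeta> ^ q\<close>, which is again a root of
  \<open>X ^ Q - X\<close>. Simplicity is tested by evaluating at \<open>\<zeta> + t\<close> with \<open>t\<close> of valuation one.\<close>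

lemma monic_relation:
  "\<exists>c. set c \<subseteq> K \<inter> V 0 \<and> length c = f \<and> eval (\<one> # c) \<zeta> = \<zero> \<and> eval (\<one> # c) (\<zeta> [^] q) = \<zero>"
proof -
  let ?A = "K \<inter> V 0"
  have A: "subring ?A L" by (rule subring_inter[OF K_subring V0_subring])
  have "\<ominus> (\<zeta> [^] f) \<in> V 0" using \<zeta>(1) by simp
  then obtain c where c: "set c \<subseteq> ?A" "length c = f" "\<ominus> (\<zeta> [^] f) = eval c \<zeta>"
    using exists_eval_\<zeta>_integral by blast
  have P: "eval (\<one> # c) \<zeta> = \<zero>" using c \<zeta>(4) by (simp add: r_neg flip: c(3))
  have PV: "set (\<one> # c) \<subseteq> V 0" using c(1) by auto
  \<comment> \<open>The list \<open>[- 1, 0]\<close> stands for -X, so \<open>h\<close> is X^Q - X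
    with coefficients among the integers of K.\<close>
  define h where "h = poly_add (monom \<one> Q) [\<ominus> \<one>, \<zero>]"
  have m: "set (monom \<one> Q) \<subseteq> ?A" "set [\<ominus> \<one>, \<zero>] \<subseteq> ?A" by (auto simp: monom_def)
  then have mC: "set (monom \<one> Q) \<subseteq> carrier L" "set [\<ominus> \<one>, \<zero>] \<subseteq> carrier L" by auto
  have hA: "set h \<subseteq> ?A"
    unfolding h_def by (rule polynomial_incl[OF poly_add_is_polynomial[OF A m]])
  have h: "eval h x = x [^] Q \<ominus> x" if x: "x \<in> carrier L" for x
    using x unfolding h_def eval_poly_add[OF mC x] by (simp add: eval_monom minus_eq l_minus)
  obtain r s where rs: "set r \<subseteq> ?A" "set s \<subseteq> ?A" "length s \<le> length c"
    and eq: "\<And>x. x \<in> carrier L \<Longrightarrow> eval h x = eval (\<one> # c) x \<otimes> eval r x \<oplus> eval s x"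
    using eval_monic_division[OF A c(1) hA] by blast
  have rV: "set r \<subseteq> V 0" and sC: "set s \<subseteq> carrier L" and rC: "set r \<subseteq> carrier L" using rs by auto
  have "eval s \<zeta> = \<zero>"
  proof -
    have "eval h \<zeta> = \<zero>" using h[OF \<zeta>(4)] \<zeta>(3,4) r_right_minus_eq[of \<zeta> \<zeta>] by simp
    then show ?thesis
      using eq[OF \<zeta>(4)] P eval_in_carrier[OF rC \<zeta>(4)] eval_in_carrier[OF sC \<zeta>(4)]
      by (simp del: eval.simps)
  qed
  \<comment> \<open>The remainder vanishes at \<zeta> and has at most f coefficients, so
    independence makes the division exact.\<close>
  then have "set s \<subseteq> {\<zero>}" using eval_\<zeta>_eq_zero[of s] rs(2,3) c(2) by auto
  then have prod: "x [^] Q \<ominus> x = eval (\<one> # c) x \<otimes> eval r x" if "x \<in> V 0" for x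
    using eq[of x] h[of x] eval_zero_coeffs[of s x] that V0_eval[OF PV that] V0_eval[OF rV that]
    by (simp del: eval.simps)
  have "red (eval r \<zeta>) \<noteq> \<zero>\<^bsub>Rk\<^esub>"
  proof
    assume zero: "red (eval r \<zeta>) = \<zero>\<^bsub>Rk\<^esub>"
    obtain t where t: "t \<in> carrier L - {\<zero>}" "w t = 1"
      using val_surj by (metis UNIV_I image_iff)
    have tV: "t \<in> V 1" "t \<in> V 0" using t by (auto simp: mem_V_iff)
    let ?x = "\<zeta> \<oplus> t"
    have x: "?x \<in> V 0" "red ?x = red \<zeta>" using tV \<zeta>(1) red_zero_iff[of t] by simp_all
    have "red (eval p ?x) = red (eval p \<zeta>)" if "set p \<subseteq> V 0" for p
      using red_eval[OF that x(1)] red_eval[OF that \<zeta>(1)] unfolding x(2) by (simp only:)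
    from this[OF PV] this[OF rV] have "eval (\<one> # c) ?x \<in> V 1" "eval r ?x \<in> V 1"
      unfolding P zero red_simps
      using red_zero_iff[OF V0_eval[OF PV x(1)]] red_zero_iff[OF V0_eval[OF rV x(1)]] by blast+
    then have 1: "?x [^] Q \<ominus> ?x \<in> V 2" using V_mult[of _ 1 _ 1] prod[OF x(1)] by simp
    \<comment> \<open>Since Q-th powers gain one in valuation, (\<zeta> + t)^Q agrees with \<zeta>
      modulo \<open>V 2\<close>. Together with the bound just found, this would put t into
      \<open>V 2\<close>.\<close>
    have "val_cong 1 ?x \<zeta>" using x \<zeta>(1) by (simp add: val_cong_1_iff)
    then have "val_cong 2 (?x [^] Q) (\<zeta> [^] Q)" using val_cong_pow_Q[of 1 ?x \<zeta>] by simp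
    then have 2: "?x [^] Q \<ominus> \<zeta> \<in> V 2" unfolding \<zeta>(3) by (simp add: val_cong_def)
    have xC: "?x [^] Q \<in> carrier L" "t \<in> carrier L" using t \<zeta>(4) by simp_all
    have "(?x [^] Q \<ominus> \<zeta>) \<ominus> (?x [^] Q \<ominus> ?x) = t" using xC \<zeta>(4) by algebra
    then have "t \<in> V 2" using V_diff[OF 2 1] by simp
    then show False using t by (simp add: mem_V_iff)
  qed
  \<comment> \<open>The reduction of \<open>r\<close> has coefficients in the base field, so its
    value at g^q is the q-th power of its value at g.\<close>
  then have "red (eval r (\<zeta> [^] q)) \<noteq> \<zero>\<^bsub>Rk\<^esub>"
    using l.eval_pow_q[OF red_K[OF rs(1)] g(1)] red_eval[OF rV \<zeta>(1)] red_eval[OF rV \<zeta>_pow_q(1)]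
      Rk.pow_eq_zeroD[of "Rk.eval (map red r) g" q] red_closed[OF V0_eval[OF rV \<zeta>(1)]] \<zeta>(2) \<zeta>_pow_q(2)
    by auto
  then have nz: "eval r (\<zeta> [^] q) \<noteq> \<zero>" by auto
  have "\<zeta> [^] q \<in> carrier L" using \<zeta>(4) by simp
  then have "eval (\<one> # c) (\<zeta> [^] q) \<otimes> eval r (\<zeta> [^] q) = \<zero>"
    using prod[OF \<zeta>_pow_q(1)] r_right_minus_eq[of "\<zeta> [^] q" "\<zeta> [^] q"] by (simp add: \<zeta>_pow_q(3) del: eval.simps)
  then have "eval (\<one> # c) (\<zeta> [^] q) = \<zero>"
    using integral[of "eval (\<one> # c) (\<zeta> [^] q)" "eval r (\<zeta> [^] q)"] nz
      V_closed[OF V0_eval[OF PV \<zeta>_pow_q(1)]] V_closed[OF V0_eval[OF rV \<zeta>_pow_q(1)]] by blast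
  then show ?thesis using c P by blast
qed

text \<open>The polynomial of \<open>monic_relation\<close> divides every relation of \<zeta> over
  K, because a remainder with at most f coefficients vanishing at \<zeta> is zero; and it vanishes
  at the q-th power of \<zeta> too.\<close>

lemma eval_\<zeta>_pow_q_eq_zero:
  assumes h: "set h \<subseteq> K" "eval h \<zeta> = \<zero>"
  shows "eval h (\<zeta> [^] q) = \<zero>"
proof -
  obtain c where c: "set c \<subseteq> K \<inter> V 0" "length c = f" "eval (\<one> # c) \<zeta> = \<zero>" "eval (\<one> # c) (\<zeta> [^] q) = \<zero>"
    using monic_relation by blast
  have cK: "set c \<subseteq> K" using c(1) by blast
  obtain r s where rs: "set r \<subseteq> K" "set s \<subseteq> K" "length s \<le> length c"
    and eq: "\<And>x. x \<in> carrier L \<Longrightarrow> eval h x = eval (\<one> # c) x \<otimes> eval r x \<oplus> eval s x"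
    using eval_monic_division[OF K_subring cK h(1)] by blast
  have rsC: "set r \<subseteq> carrier L" "set s \<subseteq> carrier L" using rs by auto
  have "eval s \<zeta> = \<zero>"
    using eq[OF \<zeta>(4)] h(2) c(3) eval_in_carrier[OF rsC(1) \<zeta>(4)] eval_in_carrier[OF rsC(2) \<zeta>(4)]
    by (simp del: eval.simps)
  then have "set s \<subseteq> {\<zero>}" using eval_\<zeta>_eq_zero[of s] rs(2,3) c(2) by auto
  moreover have "\<zeta> [^] q \<in> carrier L" using \<zeta>(4) by simp
  ultimately show ?thesis
    using eq[of "\<zeta> [^] q"] c(4) eval_in_carrier[OF rsC(1), of "\<zeta> [^] q"] eval_zero_coeffs[of s "\<zeta> [^] q"]
    by (simp del: eval.simps)
qed


section \<open>The Frobenius automorphism of L over K\<close>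

lemma \<zeta>_pow_q_carrier: "\<zeta> [^] q \<in> carrier L" using \<zeta>(4) by simp

text \<open>The choice of the polynomial is immaterial by \<open>eval_\<zeta>_pow_q_eq_zero\<close>.\<close>

definition frob :: "'a \<Rightarrow> 'a" where
  "frob = (\<lambda>x\<in>carrier L. eval (SOME p. set p \<subseteq> K \<and> x = eval p \<zeta>) (\<zeta> [^] q))"

lemma frob_eval:
  assumes p: "set p \<subseteq> K"
  shows "frob (eval p \<zeta>) = eval p (\<zeta> [^] q)"
proof -
  have pC: "set p \<subseteq> carrier L" using p by auto
  have x: "eval p \<zeta> \<in> carrier L" by (rule eval_in_carrier[OF pC \<zeta>(4)])
  define p' where "p' = (SOME p'. set p' \<subseteq> K \<and> eval p \<zeta> = eval p' \<zeta>)"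
  have "set p' \<subseteq> K \<and> eval p \<zeta> = eval p' \<zeta>"
    unfolding p'_def by (rule someI[of _ p]) (simp add: p)
  then have p': "set p' \<subseteq> K" "eval p' \<zeta> = eval p \<zeta>" by auto
  then have p'C: "set p' \<subseteq> carrier L" by auto
  have m: "\<ominus> \<one> \<in> K" "\<ominus> \<one> \<in> carrier L" by auto
  let ?p = "map ((\<otimes>) (\<ominus> \<one>)) p"
  \<comment> \<open>The difference of two representations of the same element is a relation of
    \<zeta>.\<close>
  let ?d = "poly_add p' ?p"
  have sK: "set ?p \<subseteq> K" using p m by auto
  then have sC: "set ?p \<subseteq> carrier L" by auto
  have dK: "set ?d \<subseteq> K"
    by (rule polynomial_incl[OF poly_add_is_polynomial[OF K_subring p'(1) sK]])
  have d: "eval ?d x = eval p' x \<ominus> eval p x" if x: "x \<in> carrier L" for x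
    unfolding eval_poly_add[OF p'C sC x] eval_scale[OF m(2) pC x]
    using eval_in_carrier[OF pC x] by (simp add: l_minus minus_eq)
  have "eval ?d \<zeta> = \<zero>" unfolding d[OF \<zeta>(4)] p'(2) using x r_right_minus_eq by blast
  then have "eval ?d (\<zeta> [^] q) = \<zero>" by (rule eval_\<zeta>_pow_q_eq_zero[OF dK])
  then have "eval p' (\<zeta> [^] q) = eval p (\<zeta> [^] q)"
    unfolding d[OF \<zeta>_pow_q_carrier]
    using eval_in_carrier[OF pC \<zeta>_pow_q_carrier] eval_in_carrier[OF p'C \<zeta>_pow_q_carrier] r_right_minus_eq
    by blast
  then show ?thesis unfolding frob_def p'_def using x by simp
qed

lemma frob_hom: "frob \<in> ring_hom L L"
proof (rule ring_hom_memI)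
  show "frob x \<in> carrier L" if x: "x \<in> carrier L" for x
  proof -
    obtain p where p: "set p \<subseteq> K" "x = eval p \<zeta>" using exists_eval_\<zeta>[OF x] by blast
    then have "set p \<subseteq> carrier L" by auto
    then show ?thesis unfolding p(2) frob_eval[OF p(1)] by (rule eval_in_carrier[OF _ \<zeta>_pow_q_carrier])
  qed
  fix x y assume x: "x \<in> carrier L" and y: "y \<in> carrier L"
  obtain p where p: "set p \<subseteq> K" "x = eval p \<zeta>" using exists_eval_\<zeta>[OF x] by blast
  obtain p' where p': "set p' \<subseteq> K" "y = eval p' \<zeta>" using exists_eval_\<zeta>[OF y] by blast
  have C: "set p \<subseteq> carrier L" "set p' \<subseteq> carrier L" using p p' by auto
  have add: "set (poly_add p p') \<subseteq> K"
    by (rule polynomial_incl[OF poly_add_is_polynomial[OF K_subring p(1) p'(1)]])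
  have mult: "set (poly_mult p p') \<subseteq> K"
    by (rule polynomial_incl[OF poly_mult_is_polynomial[OF K_subring p(1) p'(1)]])
  show "frob (x \<oplus> y) = frob x \<oplus> frob y"
    using frob_eval[OF add] unfolding p(2) p'(2) frob_eval[OF p(1)] frob_eval[OF p'(1)]
      eval_poly_add[OF C \<zeta>(4)] eval_poly_add[OF C \<zeta>_pow_q_carrier] .
  show "frob (x \<otimes> y) = frob x \<otimes> frob y"
    using frob_eval[OF mult] unfolding p(2) p'(2) frob_eval[OF p(1)] frob_eval[OF p'(1)]
      eval_poly_mult[OF C \<zeta>(4)] eval_poly_mult[OF C \<zeta>_pow_q_carrier] .
next
  show "frob \<one> = \<one>"
    using frob_eval[of "[\<one>]"] \<zeta>_pow_q_carrier \<zeta>(4) by simp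
qed

sublocale frob: ring_hom_ring L L frob
  by (intro ring_hom_ringI2 ring_axioms frob_hom)

lemma frob_base: "x \<in> K \<Longrightarrow> frob x = x"
  using frob_eval[of "[x]"] \<zeta>_pow_q_carrier \<zeta>(4) by simp

lemma frob_\<zeta>: "frob \<zeta> = \<zeta> [^] q"
  using frob_eval[of "[\<one>, \<zero>]"] \<zeta>_pow_q_carrier \<zeta>(4) by simp

lemma frob_pow: "x \<in> carrier L \<Longrightarrow> frob (x [^] (n::nat)) = frob x [^] n"
  by (rule frob.hom_nat_pow)

text \<open>Coefficients are fixed and \<zeta>^(q^f) = \<zeta>, so replacing \<zeta> by
  \<zeta>^(q^(f-1)) in a representation yields a preimage.\<close>

lemma frob_surj: "frob ` carrier L = carrier L"
proof (intro equalityI subsetI)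
  fix y assume "y \<in> carrier L"
  then obtain p where p: "set p \<subseteq> K" "y = eval p \<zeta>" using exists_eval_\<zeta> by blast
  then have pC: "set p \<subseteq> carrier L" by auto
  define z where "z = \<zeta> [^] (q ^ (f - 1))"
  have z: "z \<in> carrier L" using \<zeta>(4) by (simp add: z_def)
  have "frob z = (\<zeta> [^] q) [^] (q ^ (f - 1))" unfolding z_def frob_pow[OF \<zeta>(4)] frob_\<zeta> ..
  also have "\<dots> = \<zeta> [^] (q ^ Suc (f - 1))" using \<zeta>(4) by (simp add: nat_pow_pow)
  also have "\<dots> = \<zeta>" using l.f_pos \<zeta>(3) unfolding Q_eq by simp
  finally have "frob z = \<zeta>" .
  moreover have "map frob p = p" using p(1) frob_base by (intro map_idI) auto
  ultimately have "frob (eval p z) = y" using frob.eval_hom'[OF z pC] p(2) by simp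
  moreover have "eval p z \<in> carrier L" by (rule eval_in_carrier[OF pC z])
  ultimately show "y \<in> frob ` carrier L" by blast
qed auto

lemma frob_galois: "frob \<in> galois_group L K"
proof -
  have "inj_on frob (carrier L)"
    by (rule non_trivial_field_hom_is_inj[OF frob_hom field_axioms field_axioms])
  then have "frob \<in> ring_iso L L"
    using frob_hom frob_surj by (simp add: ring_iso_def bij_betw_def)
  then show ?thesis using frob_base by (simp add: galois_group_def frob_def)
qed

text \<open>A nonzero Teichmueller element is a power of \<zeta>: its residue is a power of g, and
  lifts are unique.\<close>

lemma frob_teichmueller:
  assumes "t \<in> V 0" "t [^] Q = t" shows "frob t = t [^] q"
proof (cases "t = \<zero>")
  case True
  then show ?thesis using l.q_ge_2 frob.hom_zero by (simp add: nat_pow_zero)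
next
  case False
  have "red t \<noteq> \<zero>\<^bsub>Rk\<^esub>"
  proof
    assume "red t = \<zero>\<^bsub>Rk\<^esub>"
    then have "val_cong 1 t \<zero>" using assms by (simp add: val_cong_1_iff)
    then show False
      using teichmueller_lift_unique[of t \<zero>] assms(2) False Q_ge_2 by (simp add: nat_pow_zero)
  qed
  then obtain i :: nat where i: "red t = g [^]\<^bsub>Rk\<^esub> i" using g_generates[of "red t"] assms(1) by auto
  have "(\<zeta> [^] i) [^] Q = (\<zeta> [^] Q) [^] i" using \<zeta>(4) by (simp add: nat_pow_pow mult.commute)
  then have "(\<zeta> [^] i) [^] Q = \<zeta> [^] i" by (simp add: \<zeta>(3))
  moreover have "val_cong 1 t (\<zeta> [^] i)" using i \<zeta> assms(1) by (simp add: val_cong_1_iff)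
  ultimately have t: "t = \<zeta> [^] i" using teichmueller_lift_unique assms(2) by blast
  show ?thesis
    unfolding t frob_pow[OF \<zeta>(4)] frob_\<zeta> using \<zeta>(4) by (simp add: nat_pow_pow mult.commute)
qed

end

section \<open>Ramified lines\<close>

lemma units_of_nat_pow [simp]: "x [^]\<^bsub>units_of R\<^esub> (n::nat) = x [^]\<^bsub>R\<^esub> n"
  by (simp add: nat_pow_def units_of_def)

lemma units_of_simps [simp]: "x \<otimes>\<^bsub>units_of R\<^esub> y = x \<otimes>\<^bsub>R\<^esub> y" "\<one>\<^bsub>units_of R\<^esub> = \<one>\<^bsub>R\<^esub>"
  by (simp_all add: units_of_def)

lemma Suc_geometric_sum: "Suc ((\<Sum>i<n. Suc d ^ i) * d) = Suc d ^ n"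
  by (induction n) (simp_all add: algebra_simps)

lemma (in group) subgroup_nat_pow:
  assumes "subgroup H G" "x \<in> H" shows "x [^] (n::nat) \<in> H"
  by (induction n) (use assms subgroup.one_closed subgroup.m_closed in \<open>simp_all\<close>)

text \<open>\<open>m\<close> is the exponent (q^f - 1) / e of the canonical map; as a parameter it
  keeps division out of the exponents.\<close>

locale tame_unramified_extension = unramified_extension_generator +
  fixes e m :: nat
  assumes e_pos: "0 < e" and Q_eq_Suc: "Q = Suc (e * m)"
begin

abbreviation "U \<equiv> units_of L"
abbreviation "G \<equiv> units_of Rk"
abbreviation "cls \<equiv> power_class (units_of L) e"

lemma U_carrier: "carrier U = carrier L - {\<zero>}"
  using field_Units by (simp add: units_of_carrier)

lemma G_carrier: "carrier G = carrier Rk - {\<zero>\<^bsub>Rk\<^esub>}"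
  by (rule l.units)

lemma U_comm_group: "comm_group U" by (rule units_comm_group)

lemma G_cyclic: "finite_cyclic_group G g"
proof (rule finite_cyclic_group.intro[OF Rk.units_comm_group], rule finite_cyclic_group_axioms.intro)
  show "finite (carrier G)" using finite_residue_field by (simp add: G_carrier)
  show "g \<in> carrier G" using g by (simp add: G_carrier)
  show "\<exists>i::nat. x = g [^]\<^bsub>G\<^esub> i" if "x \<in> carrier G" for x
    unfolding units_of_nat_pow using g_generates[of x] that by (simp add: G_carrier)
qed

lemma order_G: "order G = e * m" "order G = (\<Sum>i<f. q ^ i) * (q - 1)"
proof -
  have o: "order G = q ^ f - 1" by (rule l.order_units)
  then show "order G = e * m" using Q_eq_Suc by (simp add: Q_eq)
  have "(\<Sum>i<f. q ^ i) * (q - 1) = q ^ f - 1"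
    using Suc_geometric_sum[of "q - 1" f] l.q_ge_2 by simp
  then show "order G = (\<Sum>i<f. q ^ i) * (q - 1)" using o by simp
qed

lemma mult_nonzero: "x \<in> carrier L - {\<zero>} \<Longrightarrow> y \<in> carrier L - {\<zero>} \<Longrightarrow> x \<otimes> y \<in> carrier L - {\<zero>}"
  by (simp add: integral_iff)

lemma pow_nonzero: "x \<in> carrier L - {\<zero>} \<Longrightarrow> x [^] (n::nat) \<in> carrier L - {\<zero>}"
  using val_pow(1) by simp

lemma inv_nonzero: "x \<in> carrier L - {\<zero>} \<Longrightarrow> inv x \<in> carrier L - {\<zero>} \<and> x \<otimes> inv x = \<one> \<and> inv x \<otimes> x = \<one>"
  using field_Units Units_inv_Units by auto

lemma val_mult_pow:
  "x \<in> carrier L - {\<zero>} \<Longrightarrow> z \<in> carrier L - {\<zero>} \<Longrightarrow> w (x \<otimes> z [^] e) = w x + int e * w z"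
  using val_mult[of x "z [^] e"] val_pow[of z e] pow_nonzero[of z e] by simp

lemma unit_red: "x \<in> carrier L - {\<zero>} \<Longrightarrow> w x = 0 \<Longrightarrow> x \<in> V 0 \<and> red x \<in> carrier G"
  using unit_iff[of x] by (auto simp: mem_V_iff G_carrier)

lemma cls_eq_iff:
  "x \<in> carrier L - {\<zero>} \<Longrightarrow> y \<in> carrier L - {\<zero>} \<Longrightarrow>
    cls x = cls y \<longleftrightarrow> (\<exists>z\<in>carrier L - {\<zero>}. y = x \<otimes> z [^] e)"
  using comm_group.power_class_eq_iff[OF U_comm_group, of x y e] by (simp add: U_carrier)

lemma val_cls:
  assumes x: "x \<in> carrier L - {\<zero>}"
  shows "induced_map (\<lambda>x. w x mod int e) (cls x) = w x mod int e"
proof (rule induced_map_eq)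
  show "x \<in> cls x" using comm_group.power_class_self[OF U_comm_group] x by (simp add: U_carrier)
  fix y assume "y \<in> cls x"
  then obtain z where "z \<in> carrier L - {\<zero>}" "y = x \<otimes> z [^] e"
    using comm_group.mem_power_class_iff[OF U_comm_group, of x y e] x by (auto simp: U_carrier)
  then show "w y mod int e = w x mod int e" using val_mult_pow[OF x] by simp
qed

lemma cls_cases:
  assumes "ramified_line L w e D" "A \<in> D"
  obtains x where "x \<in> carrier L - {\<zero>}" "A = cls x"
proof -
  have "A \<in> carrier (power_quotient U e)"
    using assms subgroup.subset by (fastforce simp: ramified_line_def)
  then show thesis
    using that comm_group.power_quotient_carrier[OF U_comm_group, of e] by (auto simp: U_carrier)
qed

lemma line_inj:
  assumes D: "ramified_line L w e D" and "A \<in> D" "B \<in> D"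
    and "induced_map (\<lambda>x. w x mod int e) A = induced_map (\<lambda>x. w x mod int e) B"
  shows "A = B"
proof -
  have "inj_on (induced_map (\<lambda>x. w x mod int e)) D"
    using D by (simp add: ramified_line_def iso_def bij_betw_def)
  from inj_onD[OF this assms(4,2,3)] show ?thesis .
qed

text \<open>The target value is written \<open>1 mod int e\<close> because for e = 1 the cyclic
  group is trivial and its representative is 0.\<close>

lemma line_exists:
  assumes D: "ramified_line L w e D"
  shows "\<exists>x\<in>carrier L - {\<zero>}. cls x \<in> D \<and> w x mod int e = 1 mod int e"
proof -
  have "induced_map (\<lambda>x. w x mod int e) ` D = {0..<int e}"
    using D e_pos by (simp add: ramified_line_def iso_def bij_betw_def carrier_integer_mod_group)
  moreover have "1 mod int e \<in> {0..<int e}" using e_pos by simp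
  ultimately obtain A where A: "A \<in> D" "induced_map (\<lambda>x. w x mod int e) A = 1 mod int e"
    by (metis (no_types, lifting) imageE)
  then show ?thesis using cls_cases[OF D A(1)] val_cls by metis
qed

text \<open>The valuation is injective on D, so a member of valuation n modulo e can only be the
  n-th power of one of valuation 1.\<close>

lemma line_generate:
  assumes D: "ramified_line L w e D" and x: "x \<in> carrier L - {\<zero>}" "cls x \<in> D" "w x mod int e = 1 mod int e"
  shows "D = generate (power_quotient U e) {cls x}"
proof (intro equalityI subsetI)
  interpret PQ: comm_group "power_quotient U e"
    by (rule comm_group.power_quotient_comm_group[OF U_comm_group])
  have sub: "subgroup D (power_quotient U e)" using D by (simp add: ramified_line_def)
  show "B \<in> D" if "B \<in> generate (power_quotient U e) {cls x}" for B
    using PQ.generate_subgroup_incl[OF _ sub, of "{cls x}"] x(2) that by blast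
  fix B assume B: "B \<in> D"
  obtain y where y: "y \<in> carrier L - {\<zero>}" "B = cls y" using cls_cases[OF D B] .
  define n where "n = nat (w y mod int e)"
  have pow: "cls (x [^] n) = cls x [^]\<^bsub>power_quotient U e\<^esub> n"
    using comm_group.power_class_pow[OF U_comm_group, of x e n] x(1) by (simp add: U_carrier)
  have "cls x [^]\<^bsub>power_quotient U e\<^esub> n \<in> D"
    by (rule PQ.subgroup_nat_pow[OF sub x(2)])
  moreover have "w (x [^] n) mod int e = w y mod int e"
  proof -
    have "int n = w y mod int e" using e_pos by (simp add: n_def)
    then have "w (x [^] n) = (w y mod int e) * w x" using val_pow(2)[OF x(1), of n] by simp
    also have "\<dots> mod int e = (w y mod int e) * (w x mod int e) mod int e" by (simp add: mod_mult_right_eq)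
    also have "\<dots> = w y mod int e" unfolding x(3) by (simp add: mod_mult_right_eq)
    finally show ?thesis .
  qed
  ultimately have "B = cls (x [^] n)"
    using line_inj[OF D B, of "cls (x [^] n)"] val_cls[OF y(1)] val_cls[OF pow_nonzero[OF x(1)], of n]
    by (simp add: y(2) pow)
  moreover have "cls x \<in> generate (power_quotient U e) {cls x}" by (rule generate.incl) simp
  ultimately show "B \<in> generate (power_quotient U e) {cls x}"
    using PQ.subgroup_nat_pow[OF PQ.generate_is_subgroup, of "{cls x}" "cls x" n] pow
      x(2) subgroup.subset[OF sub] by auto
qed

lemma presents_lineD:
  assumes "presents_line L w K v e D \<pi> \<xi>"
  defines "t \<equiv> teichmueller L w \<xi>"
  shows "\<pi> \<in> K" "\<pi> \<in> carrier L - {\<zero>}" "w \<pi> = 1" "\<xi> \<in> carrier G"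
    "t \<in> V 0" "t \<in> carrier L - {\<zero>}" "w t = 0" "red t = \<xi>" "t [^] Q = t" "cls (t \<otimes> \<pi>) \<in> D"
proof -
  have \<pi>: "\<pi> \<in> K" "\<pi> \<noteq> \<zero>" "v \<pi> = 1" and \<xi>: "\<xi> \<in> carrier G"
    and D: "D = generate (power_quotient U e) {cls (t \<otimes> \<pi>)}"
    using assms by (auto simp: presents_line_def uniformiser_def)
  show "\<pi> \<in> K" "\<pi> \<in> carrier L - {\<zero>}" "w \<pi> = 1" "\<xi> \<in> carrier G"
    using \<pi> \<xi> prolongs_exactly[of \<pi>] by auto
  have \<xi>': "\<xi> \<in> carrier Rk" "\<xi> \<noteq> \<zero>\<^bsub>Rk\<^esub>" using \<xi> by (auto simp: G_carrier)
  note t = teichmueller[OF \<xi>'(1), folded t_def]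
  then show "t \<in> V 0" "red t = \<xi>" "t [^] Q = t" by auto
  show "t \<in> carrier L - {\<zero>}" "w t = 0" using t \<xi>' unit_iff[of t] by auto
  show "cls (t \<otimes> \<pi>) \<in> D" unfolding D by (rule generate.incl) simp
qed

text \<open>An element x of D with valuation 1 + e n is divided by an e-th power of valuation e n
  and by a uniformiser of K. The remaining unit is a Teichmueller lift times a principal unit, and
  the latter is an e-th power.\<close>

lemma exists_presentation:
  assumes D: "ramified_line L w e D"
  shows "\<exists>\<pi> \<xi>. presents_line L w K v e D \<pi> \<xi>"
proof -
  obtain x where x: "x \<in> carrier L - {\<zero>}" "cls x \<in> D" "w x mod int e = 1 mod int e"
    using line_exists[OF D] by blast
  then have "int e dvd w x - 1" by (simp add: mod_eq_dvd_iff)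
  then obtain n where "w x - 1 = int e * n" by (rule dvdE)
  then have n: "w x = 1 + int e * n" by simp
  interpret B: local_field "L\<lparr>carrier := K\<rparr>" v by (rule base_local_field)
  have "1 \<in> v ` (K - {\<zero>})" using B.val_surj by simp
  then obtain \<pi> where "1 = v \<pi>" "\<pi> \<in> K - {\<zero>}" by (rule imageE)
  then have \<pi>: "\<pi> \<in> K" "\<pi> \<noteq> \<zero>" "v \<pi> = 1" by auto
  have \<pi>': "\<pi> \<in> carrier L - {\<zero>}" "w \<pi> = 1" using \<pi> prolongs_exactly by auto
  obtain y where y: "y \<in> carrier L - {\<zero>}" "w y = n"
    using val_surj by (metis UNIV_I image_iff)
  let ?z = "\<pi> \<otimes> y [^] e"
  have z: "?z \<in> carrier L - {\<zero>}" by (intro mult_nonzero pow_nonzero \<pi>' y)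
  have "w ?z = w x" using val_mult_pow[OF \<pi>'(1) y(1)] \<pi>' y n by simp
  define u where "u = x \<otimes> inv ?z"
  have u: "u \<in> carrier L - {\<zero>}" unfolding u_def by (intro mult_nonzero x) (use inv_nonzero[OF z] in simp)
  have "w u = 0" using val_mult[OF x(1), of "inv ?z"] val_inv[OF z] inv_nonzero[OF z] \<open>w ?z = w x\<close> by (simp add: u_def)
  then have u0: "u \<in> V 0" "red u \<in> carrier G" using unit_red[OF u] by auto
  define \<xi> where "\<xi> = red u"
  have \<xi>: "\<xi> \<in> carrier Rk" "\<xi> \<noteq> \<zero>\<^bsub>Rk\<^esub>" using u0 by (auto simp: \<xi>_def G_carrier)
  define t where "t = teichmueller L w \<xi>"
  note t = teichmueller[OF \<xi>(1), folded t_def]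
  have t': "t \<in> carrier L - {\<zero>}" "w t = 0" using t \<xi> unit_iff[of t] by auto
  have ti: "inv t \<in> carrier L - {\<zero>}" "t \<otimes> inv t = \<one>" using inv_nonzero[OF t'(1)] by auto
  have "inv t \<in> V 0" using val_inv[OF t'(1)] t'(2) ti by (simp add: mem_V_iff)
  moreover have "red (u \<otimes> inv t) = \<one>\<^bsub>Rk\<^esub>"
  proof -
    have "red (t \<otimes> inv t) = red t \<otimes>\<^bsub>Rk\<^esub> red (inv t)" using t(1) \<open>inv t \<in> V 0\<close> by simp
    then show ?thesis using ti(2) u0(1) \<open>inv t \<in> V 0\<close> t(2) by (simp add: \<xi>_def)
  qed
  ultimately obtain b where b: "b \<in> V 0" "red b = \<one>\<^bsub>Rk\<^esub>" "b [^] e = u \<otimes> inv t"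
    using one_unit_root[of "u \<otimes> inv t" e m] u0(1) Q_eq_Suc by auto
  have b': "b \<in> carrier L - {\<zero>}" using b(1,2) by auto
  have "x = (t \<otimes> \<pi>) \<otimes> (b \<otimes> y) [^] e"
  proof -
    have "(t \<otimes> \<pi>) \<otimes> (b \<otimes> y) [^] e = (t \<otimes> \<pi>) \<otimes> ((u \<otimes> inv t) \<otimes> y [^] e)"
      using b' y by (simp add: nat_pow_distrib b(3))
    also have "\<dots> = (t \<otimes> inv t) \<otimes> (u \<otimes> ?z)"
      using t' ti(1) \<pi>' u y pow_nonzero[OF y(1), of e] by (simp add: m_ac)
    also have "\<dots> = x \<otimes> (inv ?z \<otimes> ?z)"
      unfolding ti(2) u_def using x z inv_nonzero[OF z] by (simp add: m_assoc)
    also have "\<dots> = x" using x inv_nonzero[OF z] by simp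
    finally show ?thesis by simp
  qed
  then have "cls (t \<otimes> \<pi>) = cls x"
    using cls_eq_iff[OF mult_nonzero[OF t'(1) \<pi>'(1)] x(1)] mult_nonzero[OF b' y(1)] by blast
  then have "D = generate (power_quotient U e) {cls (t \<otimes> \<pi>)}"
    using line_generate[OF D x] by simp
  then have "presents_line L w K v e D \<pi> \<xi>"
    using \<pi> u0(2) by (simp add: presents_line_def uniformiser_def t_def \<xi>_def)
  then show ?thesis by blast
qed

lemma line_eq:
  assumes D: "ramified_line L w e D"
    and x: "x \<in> carrier L - {\<zero>}" "cls x \<in> D" and y: "y \<in> carrier L - {\<zero>}" "cls y \<in> D" and "w x = w y"
  shows "\<exists>z\<in>carrier L - {\<zero>}. y = x \<otimes> z [^] e \<and> w z = 0"
proof -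
  have "cls x = cls y" using line_inj[OF D x(2) y(2)] val_cls[OF x(1)] val_cls[OF y(1)] assms(6) by simp
  then obtain z where z: "z \<in> carrier L - {\<zero>}" "y = x \<otimes> z [^] e" using cls_eq_iff[OF x(1) y(1)] by blast
  then have "int e * w z = 0" using val_mult_pow[OF x(1) z(1)] assms(6) by simp
  then show ?thesis using z e_pos by auto
qed

text \<open>The Frobenius automorphism sends t \<pi> to t^q \<pi>. Stability puts both in D, and
  their valuations agree, so they differ by the e-th power of a unit z. Cancelling t \<pi> leaves
  t^(q-1) = z^e, and \<alpha> is the residue of z.\<close>

lemma presentation_power:
  assumes D: "D \<in> stable_ramified_lines L w K e" and pres: "presents_line L w K v e D \<pi> \<xi>"
  shows "\<exists>\<alpha>\<in>carrier G. \<xi> [^]\<^bsub>Rk\<^esub> (q - 1) = \<alpha> [^]\<^bsub>Rk\<^esub> e"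
proof -
  define t where "t = teichmueller L w \<xi>"
  note p = presents_lineD[OF pres, folded t_def]
  have line: "ramified_line L w e D" and stable: "(\<lambda>A. frob ` A) ` D = D"
    using D frob_galois by (auto simp: stable_ramified_lines_def)
  let ?x = "t \<otimes> \<pi>" and ?y = "t [^] q \<otimes> \<pi>"
  have x: "?x \<in> carrier L - {\<zero>}" and y: "?y \<in> carrier L - {\<zero>}"
    by (intro mult_nonzero pow_nonzero p)+
  have "frob ?x = ?y"
    using p frob_teichmueller[OF p(5,9)] frob_base[OF p(1)] by simp
  have "frob ` cls ?x \<in> D" using stable p(10) by blast
  then obtain y' where y': "y' \<in> carrier L - {\<zero>}" "frob ` cls ?x = cls y'" using cls_cases[OF line] by blast
  \<comment> \<open>Stability presents the image class only as some \<open>cls y'\<close>; it is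
    identified through its member \<open>frob ?x\<close>, which is \<open>?y\<close>.\<close>
  have "?x \<in> cls ?x"
    using comm_group.power_class_self[OF U_comm_group] x by (simp add: U_carrier)
  then have "frob ?x \<in> frob ` cls ?x" by (rule imageI)
  then have "?y \<in> cls y'" unfolding \<open>frob ?x = ?y\<close> y'(2) .
  then have "cls y' = cls ?y"
    using cls_eq_iff[OF y'(1) y] comm_group.mem_power_class_iff[OF U_comm_group, of y' ?y e] y'(1)
    by (simp add: U_carrier)
  then have yD: "cls ?y \<in> D" using y'(2) \<open>frob ` cls ?x \<in> D\<close> by simp
  have "w ?x = w ?y"
    using val_mult[OF p(6,2)] val_mult[OF pow_nonzero[OF p(6)] p(2), of q] val_pow(2)[OF p(6), of q] p(7) by simp
  then obtain z where z: "z \<in> carrier L - {\<zero>}" "?y = ?x \<otimes> z [^] e" "w z = 0"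
    using line_eq[OF line x p(10) y yD] by blast
  have zV: "z \<in> V 0" "red z \<in> carrier G" using unit_red[OF z(1,3)] by auto
  have zp: "z [^] e \<in> carrier L" using z(1) by simp
  have "(t [^] (q - 1) \<otimes> t) \<otimes> \<pi> = (z [^] e \<otimes> t) \<otimes> \<pi>"
  proof -
    have "t [^] (q - 1) \<otimes> t = t [^] q" using l.q_ge_2 nat_pow_Suc[of t "q - 1"] by simp
    moreover have "?x \<otimes> z [^] e = (z [^] e \<otimes> t) \<otimes> \<pi>" using zp p by (simp add: m_ac)
    ultimately show ?thesis using z(2) by simp
  qed
  then have "t [^] (q - 1) = z [^] e"
    using p zp m_rcancel by simp
  then have "red t [^]\<^bsub>Rk\<^esub> (q - 1) = red z [^]\<^bsub>Rk\<^esub> e" using red_pow[OF p(5)] red_pow[OF zV(1)] by metis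
  then show ?thesis using zV(2) p(8) by auto
qed

text \<open>Changing the uniformiser multiplies by a unit of K. Its residue lies in the base field,
  is killed by q - 1, and is therefore an N-th power in the cyclic group. The rest of the
  discrepancy is an e-th power.\<close>

lemma presentation_unique:
  assumes D: "ramified_line L w e D"
    and pres: "presents_line L w K v e D \<pi> \<xi>" "presents_line L w K v e D \<pi>' \<xi>'"
  shows "\<exists>y\<in>carrier G. \<exists>z\<in>carrier G. \<xi>' \<otimes>\<^bsub>Rk\<^esub> y [^]\<^bsub>Rk\<^esub> (\<Sum>i<f. q ^ i) = \<xi> \<otimes>\<^bsub>Rk\<^esub> z [^]\<^bsub>Rk\<^esub> e"
proof -
  define t t' where "t = teichmueller L w \<xi>" and "t' = teichmueller L w \<xi>'"
  note p = presents_lineD[OF pres(1), folded t_def] and p' = presents_lineD[OF pres(2), folded t'_def]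
  have x: "t \<otimes> \<pi> \<in> carrier L - {\<zero>}" "t' \<otimes> \<pi>' \<in> carrier L - {\<zero>}" by (intro mult_nonzero p p')+
  have "w (t \<otimes> \<pi>) = w (t' \<otimes> \<pi>')" using val_mult[OF p(6,2)] val_mult[OF p'(6,2)] p p' by simp
  then obtain z where z: "z \<in> carrier L - {\<zero>}" "t' \<otimes> \<pi>' = t \<otimes> \<pi> \<otimes> z [^] e" "w z = 0"
    using line_eq[OF D x(1) p(10) x(2) p'(10)] by blast
  have zV: "z \<in> V 0" "red z \<in> carrier G" using unit_red[OF z(1,3)] by auto
  have inv: "inv \<pi> \<in> K" "inv \<pi> \<in> carrier L - {\<zero>}" "\<pi> \<otimes> inv \<pi> = \<one>"
    using inv_nonzero[OF p(2)] K_inv p by auto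
  define u where "u = \<pi>' \<otimes> inv \<pi>"
  have u: "u \<in> K" "u \<in> carrier L - {\<zero>}" "w u = 0"
    using inv p'(1,2) val_mult[OF p'(2) inv(2)] val_inv[OF p(2)] p(3) p'(3) mult_nonzero[OF p'(2) inv(2)]
    by (simp_all add: u_def)
  have uV: "u \<in> V 0" "red u \<in> carrier G" using unit_red[OF u(2,3)] by auto
  have "t' \<otimes> u = t \<otimes> z [^] e"
  proof -
    have "t' \<otimes> u = (t' \<otimes> \<pi>') \<otimes> inv \<pi>" using p' inv by (simp add: u_def m_assoc)
    also have "\<dots> = (t \<otimes> z [^] e) \<otimes> (\<pi> \<otimes> inv \<pi>)" unfolding z(2) using p z(1) inv(2) by (simp add: m_ac)
    finally show ?thesis using p z(1) inv(3) by simp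
  qed
  then have eq: "\<xi>' \<otimes>\<^bsub>Rk\<^esub> red u = \<xi> \<otimes>\<^bsub>Rk\<^esub> red z [^]\<^bsub>Rk\<^esub> e"
    using red_simps(2)[OF p'(5) uV(1)] red_simps(2)[OF p(5) V_pow[OF zV(1)]] red_pow[OF zV(1)] p(8) p'(8)
    by simp
  have "red u \<in> residue_base" using u(1) uV(1) by (auto simp: residue_base_eq)
  then have "red u [^]\<^bsub>Rk\<^esub> q = red u" by (rule l.base_pow_q)
  then have "red u [^]\<^bsub>Rk\<^esub> (q - 1) \<otimes>\<^bsub>Rk\<^esub> red u = \<one>\<^bsub>Rk\<^esub> \<otimes>\<^bsub>Rk\<^esub> red u"
    using l.q_ge_2 Rk.nat_pow_Suc[of "red u" "q - 1"] uV(1) by simp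
  then have "red u [^]\<^bsub>Rk\<^esub> (q - 1) = \<one>\<^bsub>Rk\<^esub>"
    using uV Rk.m_rcancel[of "red u" "red u [^]\<^bsub>Rk\<^esub> (q - 1)" "\<one>\<^bsub>Rk\<^esub>"] by (simp add: G_carrier)
  then obtain y where "y \<in> carrier G" "red u = y [^]\<^bsub>Rk\<^esub> (\<Sum>i<f. q ^ i)"
    using finite_cyclic_group.exists_root[OF G_cyclic order_G(2) uV(2)] by auto
  then show ?thesis using eq zV(2) by metis
qed


section \<open>The canonical map and the comparison of the two classes\<close>

lemma canonical_H2_map_eq:
  "canonical_H2_map Rk e q f =
    induced_map (\<lambda>A. H2_class (power_kernel G e) q f (induced_map (\<lambda>\<xi>. \<xi> [^]\<^bsub>G\<^esub> m) A))"
proof -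
  have "(q ^ f - 1) div e = m" using Q_eq_Suc e_pos by (simp add: Q_eq)
  then show ?thesis by (simp add: canonical_H2_map_def)
qed

lemma canonical_H2_map:
  shows "canonical_H2_map Rk e q f \<in> iso (H2 (power_quotient G e) q f) (H2 (power_kernel G e) q f)"
    and "\<xi> \<in> carrier G \<Longrightarrow>
      canonical_H2_map Rk e q f (H2_class (power_quotient G e) q f (power_class G e \<xi>)) =
      H2_class (power_kernel G e) q f (\<xi> [^]\<^bsub>Rk\<^esub> m)"
proof -
  interpret G: finite_cyclic_group G g by (rule G_cyclic)
  have ann: "A [^]\<^bsub>power_quotient G e\<^esub> ((\<Sum>i<f. q ^ i) * (q - 1)) = \<one>\<^bsub>power_quotient G e\<^esub>"
    if A: "A \<in> carrier (power_quotient G e)" for A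
  proof -
    obtain x where x: "x \<in> carrier G" "A = power_class G e x"
      using A G.power_quotient_carrier[of e] by auto
    have "A [^]\<^bsub>power_quotient G e\<^esub> order G = power_class G e (x [^]\<^bsub>G\<^esub> order G)"
      unfolding x(2) by (rule G.power_class_pow[OF x(1), symmetric])
    also have "\<dots> = power_class G e \<one>\<^bsub>G\<^esub>" using G.pow_order_eq_1[OF x(1)] by (simp only:)
    also have "\<dots> = \<one>\<^bsub>power_quotient G e\<^esub>"
      using hom_one[OF G.power_class_hom[of e] G.is_group] G.power_quotient_comm_group[of e]
      by (simp add: comm_group_def)
    finally show ?thesis unfolding order_G(2) .
  qed
  note iso = H2_iso[OF G.power_quotient_comm_group G.power_kernel_comm_group G.power_iso(1)[OF order_G(1)] ann]
  show "canonical_H2_map Rk e q f \<in> iso (H2 (power_quotient G e) q f) (H2 (power_kernel G e) q f)"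
    unfolding canonical_H2_map_eq by (rule iso(1))
  have apply_class: "induced_map (\<lambda>A. H2_class (power_kernel G e) q f (induced_map (\<lambda>\<xi>. \<xi> [^]\<^bsub>G\<^esub> m) A))
      (H2_class (power_quotient G e) q f A) =
      H2_class (power_kernel G e) q f (induced_map (\<lambda>\<xi>. \<xi> [^]\<^bsub>G\<^esub> m) A)"
    if "A \<in> carrier (power_quotient G e)" for A
    by (rule iso(2)[OF _ that])
  show "canonical_H2_map Rk e q f (H2_class (power_quotient G e) q f (power_class G e \<xi>)) =
      H2_class (power_kernel G e) q f (\<xi> [^]\<^bsub>Rk\<^esub> m)" if \<xi>: "\<xi> \<in> carrier G"
    unfolding canonical_H2_map_eq apply_class[OF G.power_class_in_carrier[OF \<xi>]]
      G.power_iso(2)[OF order_G(1) \<xi>] by simp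
qed

text \<open>As the norm is the N-th power, this is \<open>power_kernel_class_eq\<close> read in
  \<open>H2\<close>. The right-hand side does not involve \<alpha>, which settles the independence
  of that choice.\<close>

lemma norm_class:
  assumes \<xi>: "\<xi> \<in> carrier G" and \<alpha>: "\<alpha> \<in> carrier G" and eq: "\<xi> [^]\<^bsub>Rk\<^esub> (q - 1) = \<alpha> [^]\<^bsub>Rk\<^esub> e"
  shows "H2_class (power_kernel G e) q f (galois_norm Rk residue_base \<alpha>) =
    H2_class (power_kernel G e) q f (\<xi> [^]\<^bsub>Rk\<^esub> m)"
proof -
  interpret G: finite_cyclic_group G g by (rule G_cyclic)
  interpret PK: comm_group "power_kernel G e" by (rule G.power_kernel_comm_group)
  let ?N = "\<Sum>i<f. q ^ i"
  have eq': "\<xi> [^]\<^bsub>G\<^esub> (q - 1) = \<alpha> [^]\<^bsub>G\<^esub> e" using eq by simp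
  have "(\<xi> [^]\<^bsub>G\<^esub> m) [^]\<^bsub>G\<^esub> e = \<one>\<^bsub>G\<^esub>"
    using G.pow_order_eq_1[OF \<xi>] unfolding G.nat_pow_pow[OF \<xi>] order_G(1) by (simp only: mult.commute)
  \<comment> \<open>Since \<alpha>^e = \<xi>^(q-1), the e-th power of \<alpha>^N is \<xi> raised to
    N (q - 1), the order of the group.\<close>
  moreover have "(\<alpha> [^]\<^bsub>G\<^esub> ?N) [^]\<^bsub>G\<^esub> e = \<one>\<^bsub>G\<^esub>"
  proof -
    have "(\<alpha> [^]\<^bsub>G\<^esub> ?N) [^]\<^bsub>G\<^esub> e = (\<alpha> [^]\<^bsub>G\<^esub> e) [^]\<^bsub>G\<^esub> ?N"
      unfolding G.nat_pow_pow[OF \<alpha>] by (simp only: mult.commute)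
    also have "\<dots> = \<xi> [^]\<^bsub>G\<^esub> order G"
      unfolding eq'[symmetric] G.nat_pow_pow[OF \<xi>] order_G(2) by (simp only: mult.commute)
    also have "\<dots> = \<one>\<^bsub>G\<^esub>" by (rule G.pow_order_eq_1[OF \<xi>])
    finally show ?thesis .
  qed
  ultimately have mem: "\<xi> [^]\<^bsub>G\<^esub> m \<in> carrier (power_kernel G e)" "\<alpha> [^]\<^bsub>G\<^esub> ?N \<in> carrier (power_kernel G e)"
    unfolding power_kernel_simps using G.nat_pow_closed \<xi> \<alpha> by blast+
  have "0 < q - 1" using l.q_ge_2 by simp
  from G.power_kernel_class_eq[OF order_G this \<xi> \<alpha> eq']
  have "H2_class (power_kernel G e) q f (\<alpha> [^]\<^bsub>G\<^esub> ?N) = H2_class (power_kernel G e) q f (\<xi> [^]\<^bsub>G\<^esub> m)"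
    unfolding H2_class_eq_power_class PK.power_class_eq_iff[OF mem(2,1)] power_kernel_simps power_kernel_pow .
  moreover have "galois_norm Rk residue_base \<alpha> = \<alpha> [^]\<^bsub>G\<^esub> ?N"
    using l.galois_norm_eq[of \<alpha>] \<alpha> by (simp add: G_carrier)
  ultimately show ?thesis by simp
qed

lemma first_class_eq:
  assumes D: "ramified_line L w e D" and pres: "presents_line L w K v e D \<pi> \<xi>"
  shows "first_class L w K v e q f D = H2_class (power_quotient G e) q f (power_class G e \<xi>)"
  unfolding first_class_def
proof (rule the_equality)
  fix c assume "\<exists>\<pi> \<xi>. presents_line L w K v e D \<pi> \<xi> \<and>
    c = H2_class (power_quotient G e) q f (power_class G e \<xi>)"
  then obtain \<pi>' \<xi>' where pres': "presents_line L w K v e D \<pi>' \<xi>'"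
    and c: "c = H2_class (power_quotient G e) q f (power_class G e \<xi>')" by blast
  interpret G: finite_cyclic_group G g by (rule G_cyclic)
  interpret PQ: comm_group "power_quotient G e" by (rule G.power_quotient_comm_group)
  let ?N = "\<Sum>i<f. q ^ i"
  note \<xi> = presents_lineD(4)[OF pres] and \<xi>' = presents_lineD(4)[OF pres']
  obtain y z where y: "y \<in> carrier G" and z: "z \<in> carrier G"
    and "\<xi>' \<otimes>\<^bsub>Rk\<^esub> y [^]\<^bsub>Rk\<^esub> ?N = \<xi> \<otimes>\<^bsub>Rk\<^esub> z [^]\<^bsub>Rk\<^esub> e"
    using presentation_unique[OF D pres pres'] by blast
  then have eq: "\<xi>' \<otimes>\<^bsub>G\<^esub> y [^]\<^bsub>G\<^esub> ?N = \<xi> \<otimes>\<^bsub>G\<^esub> z [^]\<^bsub>G\<^esub> e" by simp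
  have yN: "y [^]\<^bsub>G\<^esub> ?N \<in> carrier G" by (rule G.nat_pow_closed[OF y])
  have "power_class G e \<xi> = power_class G e (\<xi>' \<otimes>\<^bsub>G\<^esub> y [^]\<^bsub>G\<^esub> ?N)"
    unfolding G.power_class_eq_iff[OF \<xi> G.m_closed[OF \<xi>' yN]] using eq z by blast
  also have "\<dots> = power_class G e \<xi>' \<otimes>\<^bsub>power_quotient G e\<^esub> power_class G e y [^]\<^bsub>power_quotient G e\<^esub> ?N"
    unfolding G.power_class_mult[OF \<xi>' yN] G.power_class_pow[OF y] ..
  finally show "c = H2_class (power_quotient G e) q f (power_class G e \<xi>)"
    unfolding c H2_class_eq_power_class
      PQ.power_class_eq_iff[OF G.power_class_in_carrier[OF \<xi>'] G.power_class_in_carrier[OF \<xi>]]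
    using G.power_class_in_carrier[OF y] by blast
qed (use pres in blast)

text \<open>Every admissible triple produces the image of the first class, so the comparison proves
  uniqueness as well; what remains is one triple, supplied by \<open>exists_presentation\<close> and
  \<open>presentation_power\<close>.\<close>

lemma second_class_eq:
  assumes D: "D \<in> stable_ramified_lines L w K e"
  shows "second_class L w K v e q f D = canonical_H2_map Rk e q f (first_class L w K v e q f D)"
proof -
  have line: "ramified_line L w e D" using D by (simp add: stable_ramified_lines_def)
  have eq: "canonical_H2_map Rk e q f (first_class L w K v e q f D) =
      H2_class (power_kernel G e) q f (galois_norm Rk residue_base \<alpha>)"
    if "presents_line L w K v e D \<pi> \<xi>" "\<alpha> \<in> carrier G"
      "\<xi> [^]\<^bsub>Rk\<^esub> (q - 1) = \<alpha> [^]\<^bsub>Rk\<^esub> e" for \<pi> \<xi> \<alpha>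
    unfolding first_class_eq[OF line that(1)] canonical_H2_map(2)[OF presents_lineD(4)[OF that(1)]]
    by (rule norm_class[OF presents_lineD(4)[OF that(1)] that(2,3), symmetric])
  obtain \<pi> \<xi> where pres: "presents_line L w K v e D \<pi> \<xi>" using exists_presentation[OF line] by blast
  obtain \<alpha> where \<alpha>: "\<alpha> \<in> carrier G" "\<xi> [^]\<^bsub>Rk\<^esub> (q - 1) = \<alpha> [^]\<^bsub>Rk\<^esub> e"
    using presentation_power[OF D pres] by blast
  show ?thesis
    unfolding second_class_def
  proof (rule the_equality)
    show "\<exists>\<pi> \<xi> \<alpha>. presents_line L w K v e D \<pi> \<xi> \<and> \<alpha> \<in> carrier G \<and>
        \<xi> [^]\<^bsub>Rk\<^esub> (q - 1) = \<alpha> [^]\<^bsub>Rk\<^esub> e \<and>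
        canonical_H2_map Rk e q f (first_class L w K v e q f D) =
          H2_class (power_kernel G e) q f (galois_norm Rk residue_base \<alpha>)"
      using eq[OF pres \<alpha>] pres \<alpha> by blast
  qed (use eq in metis)
qed

end

theorem proposition4p5p1:
  fixes L :: "('a, 'm) ring_scheme" and K :: "'a set"
    and w v :: "'a \<Rightarrow> int" and p q e f :: nat
  assumes "unramified_extension L w K v f"
    and "has_characteristic (residue_field (L\<lparr>carrier := K\<rparr>) v) p"
    and "q = card (carrier (residue_field (L\<lparr>carrier := K\<rparr>) v))"
    and "0 < e" and "\<not> [e = 0] (mod p)"
    and "0 < f" and "[q ^ f = 1] (mod e)"
  shows "canonical_H2_map (residue_field L w) e q f
           \<in> iso (H2 (power_quotient (units_of (residue_field L w)) e) q f)
                 (H2 (power_kernel (units_of (residue_field L w)) e) q f)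
       \<and> (\<forall>D \<in> stable_ramified_lines L w K e.
            canonical_H2_map (residue_field L w) e q f (first_class L w K v e q f D)
              = second_class L w K v e q f D)"
proof -
  interpret unramified_extension L w K v f by fact
  \<comment> \<open>The statement counts the residue field of K itself, the locale counts its image
    in the residue field of L.\<close>
  have q: "q = card residue_base" unfolding assms(3) by (rule card_residue_base[symmetric])
  obtain g where "g \<in> carrier Rk" "g \<noteq> \<zero>\<^bsub>Rk\<^esub>"
    "\<And>\<xi>. \<xi> \<in> carrier Rk - {\<zero>\<^bsub>Rk\<^esub>} \<Longrightarrow> \<exists>i::nat. \<xi> = g [^]\<^bsub>Rk\<^esub> i"
    by (rule l.obtain_generator) blast
  then interpret gen: unramified_extension_generator L w K v f g
    by (intro unramified_extension_generator.intro unramified_extension_axioms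
        unramified_extension_generator_axioms.intro)
  have "q ^ f = Q" using gen.Q_eq q by simp
  then have "[Q = 1] (mod e)" using assms(7) by simp
  then have "e dvd Q - 1" using cong_altdef_nat[of 1 Q e] Q_ge_2 by simp
  then obtain m where "Q - 1 = e * m" by (rule dvdE)
  then have "Q = Suc (e * m)" using Q_ge_2 by simp
  then interpret tame_unramified_extension L w K v f g e m
    by (intro tame_unramified_extension.intro gen.unramified_extension_generator_axioms
        tame_unramified_extension_axioms.intro assms(4))
  show ?thesis
    unfolding q using canonical_H2_map(1) second_class_eq by simp
qed

end
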